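(* Let $(\boldsymbol X^{m+1},\mu^{m+1},c_l^{m+1},c_r^{m+1})$ be a solution of the corrected scheme (S* ) described in the context. Assume that the anisotropy function satisfies $\gamma(-\boldsymbol n)<3\,\gamma(\boldsymbol n)$ for all $\boldsymbol n\in\mathbb S^1$ and that the stabilizing function $k(\boldsymbol n)$ in $\mathbf Z_k(\boldsymbol n)$ is taken sufficiently large. Then for $m=0,\ldots,K-1$ the unconditional energy stability estimate $$\frac{W(\boldsymbol X^{m+1})-W(\boldsymbol X^m)}{\Delta t}+\big\langle|\mu_\rho^{m+1}|^2,\,|\boldsymbol X_\rho^m|^{-1}\big\rangle+\frac1\eta\left[\Big(\frac{c_r^{m+1}-c_r^m}{\Delta t}\Big)^2+\Big(\frac{c_l^{m+1}-c_l^m}{\Delta t}\Big)^2\right]\le 0$$ holds. Moreover, for $m=0,\ldots,K-1$, $$M(\boldsymbol X^{m+1})-M(\boldsymbol X^m)=0.$$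
   Context: Conventions. For $\boldsymbol v=(v_1,v_2)^T\in\mathbb R^2$, $\boldsymbol v^\perp=(v_2,-v_1)^T$ is the clockwise rotation by $\pi/2$. Constants: $\sigma\in\mathbb R$, $\eta\in(0,\infty)$, $\Delta t=T/K>0$, where $K\in\mathbb N$ is the number of time steps on $[0,T]$. Anisotropy. $\gamma\in C^0(\mathbb R^2)\cap C^2(\mathbb R^2\setminus\{\boldsymbol 0\})$, $\gamma>0$ on $\mathbb R^2\setminus\{\boldsymbol 0\}$, and $\gamma(\lambda\boldsymbol p)=\lambda\gamma(\boldsymbol p)$ for all $\lambda>0$, $\boldsymbol p\in\mathbb R^2$. For $k:\mathbb S^1\to\mathbb R$ and $\boldsymbol n\in\mathbb S^1$, $$\mathbf Z_k(\boldsymbol n)=\gamma(\boldsymbol n)I_2-\boldsymbol n\,\nabla\gamma(\boldsymbol n)^T-\nabla\gamma(\boldsymbol n)\,\boldsymbol n^T+k(\boldsymbol n)\,\boldsymbol n\,\boldsymbol n^T .$$ Substrate. A smooth curve $\boldsymbol r=(r_1,r_2)^T:[0,L_{\rm sub}]\to\mathbb R^2$ parameterized by arclength, $|\boldsymbol r_c|=1$, with unit normal $\boldsymbol n_{\rm sub}(c)=-(\boldsymbol r_c(c))^\perp$. Put $$F(c_1,c_2)=\tfrac12(r_1(c_2)-r_1(c_1))(r_2(c_2)+r_2(c_1))-\tfrac12\int_{c_1}^{c_2}\boldsymbol r\cdot\boldsymbol n_{\rm sub}\,dc,$$ introduced as the area between the substrate curve and the line segment connecting $\boldsymbol r(c_1)$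 and $\boldsymbol r(c_2)$. Finite elements. $\mathbb I=(0,1)$, $q_j=jh$, $h=1/N$, $\mathbb I_j=[q_{j-1},q_j]$, $j=1,\dots,N$. $\mathcal V^h$ is the space of continuous functions on $[0,1]$ that are affine on each $\mathbb I_j$. $\mathcal S^h_{c_l,c_r}=\{\boldsymbol\eta\in[\mathcal V^h]^2:\boldsymbol\eta(0)=\boldsymbol r(c_l),\ \boldsymbol\eta(1)=\boldsymbol r(c_r)\}$. Given $c_l^m,c_r^m,c_l^{m+1},c_r^{m+1}\in[0,L_{\rm sub}]$, $$\mathcal V^{m+1}_{c_l,c_r}=\{\boldsymbol\eta\in[\mathcal V^h]^2:\boldsymbol\eta(0)\cdot(\boldsymbol r(c_l^{m+1})-\boldsymbol r(c_l^m))^\perp=0,\ \boldsymbol\eta(1)\cdot(\boldsymbol r(c_r^{m+1})-\boldsymbol r(c_r^m))^\perp=0\}.$$ $\langle\cdot,\cdot\rangle$ is the $L^2$ inner product on $\mathbb I$, and the mass-lumped product is $\langle\boldsymbol v,\boldsymbol w\rangle^h=\frac h2\sum_{j=1}^N[(\boldsymbol v\cdot\boldsymbol w)(q_j^-)+(\boldsymbol v\cdot\boldsymbol w)(q_{j-1}^+)]$ for piecewise continuous functions with possible jumps at nodes (one-sided limits). Discrete curves. $\boldsymbol X^m\in\mathcal S^h_{c_l^m,c_r^m}$ with $|\boldsymbol X^m_\rho|>0$ on each element; $\boldsymbol n^m=-(\boldsymbol X^m_\rho)^\perp/|\boldsymbol X^m_\rho|$; $\boldsymbol n^{m+\frac12}=-\frac{1}{2|\boldsymbol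 X^m_\rho|}(\boldsymbol X^m_\rho+\boldsymbol X^{m+1}_\rho)^\perp$. For $\boldsymbol r(c)\ne\boldsymbol r(c')$, $\boldsymbol G(c,c')=\dfrac{(c'-c)(\boldsymbol r(c')-\boldsymbol r(c))}{|\boldsymbol r(c')-\boldsymbol r(c)|^2}$. Corrected normal. $\boldsymbol n^{m+\frac12}_*=\boldsymbol n^{m+\frac12}+\delta\boldsymbol n^{m+\frac12}$, where $\delta\boldsymbol n^{m+\frac12}\in[\mathcal V^h]^2$ has nodal values $$\delta\boldsymbol n^{m+\frac12}(q_0)=-\frac{2F(c_l^m,c_l^{m+1})}{|\boldsymbol r(c_l^{m+1})-\boldsymbol r(c_l^m)|^2}\,\frac{\boldsymbol r(c_l^{m+1})-\boldsymbol r(c_l^m)}{|\boldsymbol X^m(q_1)-\boldsymbol X^m(q_0)|},\qquad \delta\boldsymbol n^{m+\frac12}(q_N)=\frac{2F(c_r^m,c_r^{m+1})}{|\boldsymbol r(c_r^{m+1})-\boldsymbol r(c_r^m)|^2}\,\frac{\boldsymbol r(c_r^{m+1})-\boldsymbol r(c_r^m)}{|\boldsymbol X^m(q_N)-\boldsymbol X^m(q_{N-1})|},$$ and $\delta\boldsymbol n^{m+\frac12}(q_j)=\boldsymbol 0$ for $1\le j\le N-1$. Energy and mass. With $\Gamma^m=\boldsymbol X^m([0,1])$, $W(\boldsymbol X^m)=\int_{\Gamma^m}\gamma(\boldsymbol n^m)\,ds-\sigma(c_r^m-c_l^m)$ and $M(\boldsymbol X^m)=\frac12\int_{\Gamma^m}\boldsymbol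 X^m\cdot\boldsymbol n^m\,ds-\frac12\int_{c_l^m}^{c_r^m}\boldsymbol r\cdot\boldsymbol n_{\rm sub}\,dc$, where $ds=|\boldsymbol X^m_\rho|\,d\rho$. Scheme (S* ). Given $\boldsymbol X^0$ with $\boldsymbol X^0(0)=\boldsymbol r(c_l^0)$, $\boldsymbol X^0(1)=\boldsymbol r(c_r^0)$, for $m\ge0$ find $c_l^{m+1},c_r^{m+1}\in[0,L_{\rm sub}]$ (with $\boldsymbol r(c_l^{m+1})\neq\boldsymbol r(c_l^m)$ and $\boldsymbol r(c_r^{m+1})\ne\boldsymbol r(c_r^m)$, so that all terms are defined), $\boldsymbol X^{m+1}\in\mathcal S^h_{c_l^{m+1},c_r^{m+1}}$ with $\boldsymbol X^{m+1}-\boldsymbol X^m\in\mathcal V^{m+1}_{c_l,c_r}$, and $\mu^{m+1}\in\mathcal V^h$ such that $$\tfrac1{\Delta t}\big\langle(\boldsymbol X^{m+1}-\boldsymbol X^m)\cdot\boldsymbol n^{m+\frac12}_*,\chi^h|\boldsymbol X^m_\rho|\big\rangle^h+\big\langle\mu^{m+1}_\rho,\chi^h_\rho|\boldsymbol X^m_\rho|^{-1}\big\rangle=0\quad\forall\chi^h\in\mathcal V^h,$$ $$\big\langle\mu^{m+1}\boldsymbol n^{m+\frac12}_*,\boldsymbol\zeta^h|\boldsymbol X^m_\rho|\big\rangle^h-\big\langle\mathbf Z_k(\boldsymbol n^m)\boldsymbol X^{m+1}_\rho,\boldsymbol\zeta^h_\rho|\boldsymbol X^m_\rho|^{-1}\big\rangle+\sigma\big[\boldsymbol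 G(c_r^m,c_r^{m+1})\cdot\boldsymbol\zeta^h(1)-\boldsymbol G(c_l^m,c_l^{m+1})\cdot\boldsymbol\zeta^h(0)\big]$$ $$-\tfrac1{\eta\Delta t}\big[(c_r^{m+1}-c_r^m)\boldsymbol G(c_r^m,c_r^{m+1})\cdot\boldsymbol\zeta^h(1)+(c_l^{m+1}-c_l^m)\boldsymbol G(c_l^m,c_l^{m+1})\cdot\boldsymbol\zeta^h(0)\big]=0\quad\forall\boldsymbol\zeta^h\in\mathcal V^{m+1}_{c_l,c_r}.$$
   Formalization: F is taken as the signed area it is described as, ½(r₁(c₂)−r₁(c₁))(r₂(c₂)+r₂(c₁)) − ∫ r₂ dr₁, instead of the displayed formula (which differs by ½[r₁r₂] from c₁ to c₂), since with the displayed F mass conservation fails, e.g. for the flat substrate r(c)=(c−5,1). *)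

theory Defs
  imports "HOL-Analysis.Analysis"
begin

definition perp :: "real^2 \<Rightarrow> real^2" where
  "perp v = vector [v $ 2, - (v $ 1)]"

definition outer :: "real^2 \<Rightarrow> real^2 \<Rightarrow> real^2^2" where
  "outer u v = (\<chi> i j. u $ i * v $ j)"


section \<open>Anisotropy\<close>

definition grad :: "(real^2 \<Rightarrow> real) \<Rightarrow> real^2 \<Rightarrow> real^2" where
  "grad f p = (THE D. GDERIV f p :> D)"

definition C2_on :: "(real^2 \<Rightarrow> real) \<Rightarrow> (real^2) set \<Rightarrow> bool" where
  "C2_on f S \<longleftrightarrow> (\<exists>g (H :: real^2 \<Rightarrow> real^2^2).
     (\<forall>p\<in>S. GDERIV f p :> g p) \<and>
     (\<forall>p\<in>S. (g has_derivative (\<lambda>v. H p *v v)) (at p)) \<and>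
     continuous_on S H)"

definition anisotropy :: "(real^2 \<Rightarrow> real) \<Rightarrow> bool" where
  "anisotropy \<gamma> \<longleftrightarrow>
     continuous_on UNIV \<gamma> \<and> C2_on \<gamma> (UNIV - {0}) \<and>
     (\<forall>p. p \<noteq> 0 \<longrightarrow> \<gamma> p > 0) \<and>
     (\<forall>l p. l > 0 \<longrightarrow> \<gamma> (l *\<^sub>R p) = l * \<gamma> p)"

definition Zmat :: "(real^2 \<Rightarrow> real) \<Rightarrow> (real^2 \<Rightarrow> real) \<Rightarrow> real^2 \<Rightarrow> real^2^2" where
  "Zmat \<gamma> k n = \<gamma> n *\<^sub>R mat 1 - outer n (grad \<gamma> n) - outer (grad \<gamma> n) n + k n *\<^sub>R outer n n"


section \<open>Substrate\<close>

definition smooth_on_Icc :: "real \<Rightarrow> real \<Rightarrow> (real \<Rightarrow> real^2) \<Rightarrow> bool" where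
  "smooth_on_Icc a b f \<longleftrightarrow> (\<exists>D :: nat \<Rightarrow> real \<Rightarrow> real^2.
     (\<forall>x\<in>{a..b}. D 0 x = f x) \<and>
     (\<forall>j. \<forall>x\<in>{a..b}. (D j has_vector_derivative D (Suc j) x) (at x within {a..b})))"

definition sub_deriv :: "(real \<Rightarrow> real^2) \<Rightarrow> real \<Rightarrow> real \<Rightarrow> real^2" where
  "sub_deriv r L c = vector_derivative r (at c within {0..L})"

definition substrate :: "(real \<Rightarrow> real^2) \<Rightarrow> real \<Rightarrow> bool" where
  "substrate r L \<longleftrightarrow> L > 0 \<and> smooth_on_Icc 0 L r \<and> (\<forall>c\<in>{0..L}. norm (sub_deriv r L c) = 1)"

definition n_sub :: "(real \<Rightarrow> real^2) \<Rightarrow> real \<Rightarrow> real \<Rightarrow> real^2" where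
  "n_sub r L c = - perp (sub_deriv r L c)"

text \<open>The signed area between the chord from \<open>r c1\<close> to \<open>r c2\<close> and the substrate arc: the area
  under the chord (a trapezoid) minus the area under the arc, \<open>\<integral> r\<^sub>2 dr\<^sub>1\<close>. In the source, the
  displayed formula has one half of the integral of \<open>r \<bullet> n_sub\<close> in place of \<open>\<integral> r\<^sub>2 dr\<^sub>1\<close>. That
  formula lacks the boundary term shown in \<open>F_area_eq\<close> below: it is not invariant under
  translations, it does not vanish for the straight substrate \<open>r c = (c, 1)\<close>, and mass is not
  conserved with it. The two agree whenever \<open>r\<^sub>1 r\<^sub>2\<close> has the same value at \<open>c1\<close> and \<open>c2\<close>, in
  particular for a substrate on the \<open>x\<^sub>1\<close>-axis.\<close>

definition F_area :: "(real \<Rightarrow> real^2) \<Rightarrow> real \<Rightarrow> real \<Rightarrow> real \<Rightarrow> real" where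
  "F_area r L c1 c2 =
     (r c2 $ 1 - r c1 $ 1) * (r c2 $ 2 + r c1 $ 2) / 2
     - (LBINT c=c1..c2. r c $ 2 * sub_deriv r L c $ 1)"

lemma F_area_eq:
  assumes "substrate r L" "c1 \<in> {0..L}" "c2 \<in> {0..L}"
  shows "F_area r L c1 c2 =
     ((r c2 $ 1 - r c1 $ 1) * (r c2 $ 2 + r c1 $ 2) / 2
       - (LBINT c=c1..c2. r c \<bullet> n_sub r L c) / 2)
     - (r c2 $ 1 * r c2 $ 2 - r c1 $ 1 * r c1 $ 2) / 2"
proof -
  obtain D where D0: "\<And>x. x \<in> {0..L} \<Longrightarrow> D 0 x = r x"
    and D: "\<And>j x. x \<in> {0..L} \<Longrightarrow> (D j has_vector_derivative D (Suc j) x) (at x within {0..L})"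
    using assms(1) unfolding substrate_def smooth_on_Icc_def by blast
  have L: "L > 0" using assms(1) by (simp add: substrate_def)
  let ?S = "{min c1 c2..max c1 c2}"
  have S: "?S \<subseteq> {0..L}" using assms(2,3) by auto
  have rD: "(r has_vector_derivative D (Suc 0) x) (at x within {0..L})" if "x \<in> {0..L}" for x
    using D[OF that, of 0] has_vector_derivative_transform[OF that, of r "D 0"] D0 that by metis
  have sd: "sub_deriv r L x = D (Suc 0) x" if "x \<in> {0..L}" for x
    unfolding sub_deriv_def
    using vector_derivative_within_closed_interval[OF L that rD[OF that]] .
  have cr: "continuous_on ?S r"
    using continuous_on_subset[OF continuous_on_vector_derivative[OF rD] S] .
  have cD: "continuous_on ?S (sub_deriv r L)"
    using continuous_on_subset[OF continuous_on_vector_derivative[OF D] S] sd S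
    by (metis (no_types, lifting) continuous_on_cong subsetD)
  define f where "f = (\<lambda>c. r c $ 2 * sub_deriv r L c $ 1)"
  define g where "g = (\<lambda>c. r c \<bullet> n_sub r L c)"
  have cf: "continuous_on ?S f" unfolding f_def by (intro continuous_intros cr cD)
  have g: "g = (\<lambda>c. r c $ 2 * sub_deriv r L c $ 1 - r c $ 1 * sub_deriv r L c $ 2)"
    by (auto simp: g_def n_sub_def perp_def inner_vec_def sum_2 vector_2)
  have cg: "continuous_on ?S g" unfolding g by (intro continuous_intros cr cD)
  have der: "((\<lambda>c. r c $ 1 * r c $ 2) has_vector_derivative (2 * f x - g x)) (at x within ?S)"
    if "x \<in> ?S" for x
  proof -
    have "(r has_vector_derivative sub_deriv r L x) (at x within ?S)"
      using has_vector_derivative_within_subset[OF rD S] sd that S by (metis subsetD)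
    then have "((\<lambda>c. r c $ i) has_vector_derivative sub_deriv r L x $ i) (at x within ?S)" for i
      by (rule bounded_linear.has_vector_derivative[OF bounded_linear_vec_nth])
    then have "((\<lambda>c. r c $ i) has_real_derivative sub_deriv r L x $ i) (at x within ?S)" for i
      by (simp add: has_real_derivative_iff_has_vector_derivative)
    from DERIV_mult[OF this[of 1] this[of 2]] show ?thesis
      by (simp add: has_real_derivative_iff_has_vector_derivative f_def g algebra_simps)
  qed
  have "(LBINT c=c1..c2. 2 * f c - g c) = r c2 $ 1 * r c2 $ 2 - r c1 $ 1 * r c1 $ 2"
    by (rule interval_integral_FTC_finite[where F="\<lambda>c. r c $ 1 * r c $ 2"])
       (use cf cg der in \<open>auto intro!: continuous_intros\<close>)
  moreover have int: "interval_lebesgue_integrable lborel c1 c2 h"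
    if "continuous_on ?S h" for h :: "real \<Rightarrow> real"
  proof (cases "c1 \<le> c2")
    case True
    then show ?thesis using that by (auto intro!: interval_integrable_continuous_on)
  next
    case False
    then have "interval_lebesgue_integrable lborel c2 c1 h"
      using that by (auto intro!: interval_integrable_continuous_on)
    then show ?thesis using interval_integrable_endpoints_reverse by blast
  qed
  have "(LBINT c=c1..c2. 2 * f c - g c) = 2 * (LBINT c=c1..c2. f c) - (LBINT c=c1..c2. g c)"
    using int[OF cf] int[OF cg] by (subst interval_lebesgue_integral_diff) auto
  ultimately show ?thesis unfolding F_area_def f_def[symmetric] g_def[symmetric]
    by (simp add: f_def g_def field_simps)
qed

definition Gvec :: "(real \<Rightarrow> real^2) \<Rightarrow> real \<Rightarrow> real \<Rightarrow> real^2" where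
  "Gvec r c c' = ((c' - c) / (norm (r c' - r c))\<^sup>2) *\<^sub>R (r c' - r c)"


section \<open>Finite elements\<close>

definition node :: "nat \<Rightarrow> nat \<Rightarrow> real" where
  "node N j = real j * (1 / real N)"

definition Vh :: "nat \<Rightarrow> (real \<Rightarrow> real) set" where
  "Vh N = {f. continuous_on {0..1} f \<and>
     (\<forall>j\<in>{1..N}. \<exists>a b. \<forall>x\<in>{node N (j-1)..node N j}. f x = a * x + b)}"

definition Vh2 :: "nat \<Rightarrow> (real \<Rightarrow> real^2) set" where
  "Vh2 N = {f. \<forall>i. (\<lambda>x. f x $ i) \<in> Vh N}"

definition Sh :: "nat \<Rightarrow> (real \<Rightarrow> real^2) \<Rightarrow> real \<Rightarrow> real \<Rightarrow> (real \<Rightarrow> real^2) set" where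
  "Sh N r cl cr = {f \<in> Vh2 N. f 0 = r cl \<and> f 1 = r cr}"

text \<open>In the arguments of the following definitions, \<open>cl, cr\<close> belong to the old time level and
  \<open>cl', cr'\<close> to the new one.\<close>

definition Vtest :: "nat \<Rightarrow> (real \<Rightarrow> real^2) \<Rightarrow> real \<Rightarrow> real \<Rightarrow> real \<Rightarrow> real \<Rightarrow> (real \<Rightarrow> real^2) set" where
  "Vtest N r cl cr cl' cr' = {f \<in> Vh2 N.
     f 0 \<bullet> perp (r cl' - r cl) = 0 \<and> f 1 \<bullet> perp (r cr' - r cr) = 0}"

text \<open>For finite element functions, the values of \<open>drho\<close> at the nodes are irrelevant: they enter
  neither the integrals nor the one-sided limits below.\<close>

definition drho :: "(real \<Rightarrow> 'a::real_normed_vector) \<Rightarrow> real \<Rightarrow> 'a" where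
  "drho f \<rho> = vector_derivative f (at \<rho>)"

definition L2ip :: "(real \<Rightarrow> 'a::real_inner) \<Rightarrow> (real \<Rightarrow> 'a) \<Rightarrow> real" where
  "L2ip u v = integral {0..1} (\<lambda>\<rho>. u \<rho> \<bullet> v \<rho>)"

definition lumped :: "nat \<Rightarrow> (real \<Rightarrow> 'a::real_inner) \<Rightarrow> (real \<Rightarrow> 'a) \<Rightarrow> real" where
  "lumped N u v = (1 / real N) / 2 * (\<Sum>j=1..N.
     Lim (at_left (node N j)) (\<lambda>\<rho>. u \<rho> \<bullet> v \<rho>) +
     Lim (at_right (node N (j-1))) (\<lambda>\<rho>. u \<rho> \<bullet> v \<rho>))"


section \<open>Discrete curves\<close>

definition nondegenerate :: "nat \<Rightarrow> (real \<Rightarrow> real^2) \<Rightarrow> bool" where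
  "nondegenerate N X \<longleftrightarrow>
     (\<forall>j\<in>{1..N}. \<forall>\<rho>\<in>{node N (j-1)<..<node N j}. norm (drho X \<rho>) > 0)"

definition normal :: "(real \<Rightarrow> real^2) \<Rightarrow> real \<Rightarrow> real^2" where
  "normal X \<rho> = - ((1 / norm (drho X \<rho>)) *\<^sub>R perp (drho X \<rho>))"

definition normal_half :: "(real \<Rightarrow> real^2) \<Rightarrow> (real \<Rightarrow> real^2) \<Rightarrow> real \<Rightarrow> real^2" where
  "normal_half X Y \<rho> = - ((1 / (2 * norm (drho X \<rho>))) *\<^sub>R perp (drho X \<rho> + drho Y \<rho>))"

definition is_delta_normal ::
  "nat \<Rightarrow> (real \<Rightarrow> real^2) \<Rightarrow> real \<Rightarrow> (real \<Rightarrow> real^2) \<Rightarrow> real \<Rightarrow> real \<Rightarrow> real \<Rightarrow> real \<Rightarrow> (real \<Rightarrow> real^2) \<Rightarrow> bool" where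
  "is_delta_normal N r L X cl cr cl' cr' \<delta> \<longleftrightarrow>
     \<delta> \<in> Vh2 N \<and>
     \<delta> (node N 0) = - ((2 * F_area r L cl cl' / (norm (r cl' - r cl))\<^sup>2) *\<^sub>R
        ((1 / norm (X (node N 1) - X (node N 0))) *\<^sub>R (r cl' - r cl))) \<and>
     \<delta> (node N N) = (2 * F_area r L cr cr' / (norm (r cr' - r cr))\<^sup>2) *\<^sub>R
        ((1 / norm (X (node N N) - X (node N (N-1)))) *\<^sub>R (r cr' - r cr)) \<and>
     (\<forall>j\<in>{1..N-1}. \<delta> (node N j) = 0)"

definition energy ::
  "(real^2 \<Rightarrow> real) \<Rightarrow> real \<Rightarrow> (real \<Rightarrow> real^2) \<Rightarrow> real \<Rightarrow> real \<Rightarrow> real" where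
  "energy \<gamma> \<sigma> X cl cr =
     integral {0..1} (\<lambda>\<rho>. \<gamma> (normal X \<rho>) * norm (drho X \<rho>)) - \<sigma> * (cr - cl)"

definition mass ::
  "(real \<Rightarrow> real^2) \<Rightarrow> real \<Rightarrow> (real \<Rightarrow> real^2) \<Rightarrow> real \<Rightarrow> real \<Rightarrow> real" where
  "mass r L X cl cr =
     integral {0..1} (\<lambda>\<rho>. (X \<rho> \<bullet> normal X \<rho>) * norm (drho X \<rho>)) / 2
     - (LBINT c=cl..cr. r c \<bullet> n_sub r L c) / 2"


section \<open>The corrected scheme\<close>

text \<open>One time step, from \<open>(X, cl, cr)\<close> to \<open>(Y, \<mu>, cl', cr')\<close>. The function \<open>\<delta>\<close> is determined on
  \<open>[0,1]\<close> by its nodal values.\<close>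

definition scheme_step ::
  "(real^2 \<Rightarrow> real) \<Rightarrow> (real^2 \<Rightarrow> real) \<Rightarrow> real \<Rightarrow> real \<Rightarrow> real \<Rightarrow> (real \<Rightarrow> real^2) \<Rightarrow> real \<Rightarrow> nat \<Rightarrow>
   (real \<Rightarrow> real^2) \<Rightarrow> real \<Rightarrow> real \<Rightarrow>
   (real \<Rightarrow> real^2) \<Rightarrow> (real \<Rightarrow> real) \<Rightarrow> real \<Rightarrow> real \<Rightarrow> bool" where
  "scheme_step \<gamma> k \<sigma> \<eta> dt r L N X cl cr Y \<mu> cl' cr' \<longleftrightarrow>
     cl' \<in> {0..L} \<and> cr' \<in> {0..L} \<and> r cl' \<noteq> r cl \<and> r cr' \<noteq> r cr \<and>
     Y \<in> Sh N r cl' cr' \<and> (\<lambda>\<rho>. Y \<rho> - X \<rho>) \<in> Vtest N r cl cr cl' cr' \<and> \<mu> \<in> Vh N \<and>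
     (\<exists>\<delta>. is_delta_normal N r L X cl cr cl' cr' \<delta> \<and>
       (let nstar = (\<lambda>\<rho>. normal_half X Y \<rho> + \<delta> \<rho>) in
        (\<forall>\<phi>\<in>Vh N.
           1 / dt * lumped N (\<lambda>\<rho>. (Y \<rho> - X \<rho>) \<bullet> nstar \<rho>) (\<lambda>\<rho>. \<phi> \<rho> * norm (drho X \<rho>))
           + L2ip (drho \<mu>) (\<lambda>\<rho>. drho \<phi> \<rho> * inverse (norm (drho X \<rho>))) = 0) \<and>
        (\<forall>\<zeta>\<in>Vtest N r cl cr cl' cr'.
           lumped N (\<lambda>\<rho>. \<mu> \<rho> *\<^sub>R nstar \<rho>) (\<lambda>\<rho>. norm (drho X \<rho>) *\<^sub>R \<zeta> \<rho>)
           - L2ip (\<lambda>\<rho>. Zmat \<gamma> k (normal X \<rho>) *v drho Y \<rho>)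
                  (\<lambda>\<rho>. inverse (norm (drho X \<rho>)) *\<^sub>R drho \<zeta> \<rho>)
           + \<sigma> * (Gvec r cr cr' \<bullet> \<zeta> 1 - Gvec r cl cl' \<bullet> \<zeta> 0)
           - 1 / (\<eta> * dt) * ((cr' - cr) * (Gvec r cr cr' \<bullet> \<zeta> 1)
                              + (cl' - cl) * (Gvec r cl cl' \<bullet> \<zeta> 0)) = 0)))"

text \<open>Nondegeneracy is required only of the curves from which a step is taken.\<close>

definition scheme_solution ::
  "(real^2 \<Rightarrow> real) \<Rightarrow> (real^2 \<Rightarrow> real) \<Rightarrow> real \<Rightarrow> real \<Rightarrow> real \<Rightarrow> (real \<Rightarrow> real^2) \<Rightarrow> real \<Rightarrow> nat \<Rightarrow> nat \<Rightarrow>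
   (nat \<Rightarrow> real \<Rightarrow> real^2) \<Rightarrow> (nat \<Rightarrow> real \<Rightarrow> real) \<Rightarrow> (nat \<Rightarrow> real) \<Rightarrow> (nat \<Rightarrow> real) \<Rightarrow> bool" where
  "scheme_solution \<gamma> k \<sigma> \<eta> dt r L N K X \<mu> cl cr \<longleftrightarrow>
     cl 0 \<in> {0..L} \<and> cr 0 \<in> {0..L} \<and> X 0 \<in> Sh N r (cl 0) (cr 0) \<and>
     (\<forall>m<K. nondegenerate N (X m) \<and>
       scheme_step \<gamma> k \<sigma> \<eta> dt r L N (X m) (cl m) (cr m)
         (X (Suc m)) (\<mu> (Suc m)) (cl (Suc m)) (cr (Suc m)))"

end

theory Submission
  imports Defs
begin

text \<open>Energy: test the two equations with \<open>\<mu>\<close> and with the increment \<open>Y - X\<close>. On each element it remains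
  to bound the increment of \<open>\<gamma>(n) |X\<^sub>\<rho>|\<close> by \<open>Z\<^sub>k(n) Y\<^sub>\<rho> \<bullet> (Y\<^sub>\<rho> - X\<^sub>\<rho>) / |X\<^sub>\<rho>|\<close>. By homogeneity \<open>X\<^sub>\<rho>\<close> may be
  taken to be a unit vector; in the frame of \<open>X\<^sub>\<rho>\<close> and \<open>n\<close> the right-hand side is a quadratic polynomial in
  the coordinates of \<open>Y\<^sub>\<rho>\<close> in which \<open>k\<close> multiplies the square of the normal coordinate. A second-order
  expansion of \<open>\<gamma>\<close> settles the neighbourhood of \<open>X\<^sub>\<rho>\<close>; near the line spanned by \<open>X\<^sub>\<rho>\<close> the worst case is
  \<open>Y\<^sub>\<rho> = - X\<^sub>\<rho>\<close>, which is where \<open>\<gamma>(-n) < 3 \<gamma>(n)\<close> enters; elsewhere a large \<open>k\<close> dominates.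

  Mass: test the first equation with \<open>1\<close>. Since the half-step normal averages the two curves, the lumped
  product is the difference of the enclosed areas up to boundary cross products, and these are what
  the corrections at the two contact points compensate.\<close>

section \<open>The local energy estimate\<close>

lemma grad_eqI:
  assumes "GDERIV f p :> D"
  shows "grad f p = D"
  unfolding grad_def
proof (rule the_equality)
  fix E assume "GDERIV f p :> E"
  then have "(\<lambda>h. h \<bullet> E) = (\<lambda>h. h \<bullet> D)"
    using assms has_derivative_unique unfolding gderiv_def by blast
  then have "\<And>h. h \<bullet> E = h \<bullet> D" by meson
  then show "E = D" by (metis vector_eq_ldot)
qed (rule assms)

section \<open>Positively homogeneous anisotropies: gradient, second-order expansion, uniform
  bounds\<close>

context
  fixes \<gamma> :: "real^2 \<Rightarrow> real"
  assumes aniso: "anisotropy \<gamma>"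
begin

lemma anisotropy_pos: "p \<noteq> 0 \<Longrightarrow> \<gamma> p > 0"
  and anisotropy_scale: "l > 0 \<Longrightarrow> \<gamma> (l *\<^sub>R p) = l * \<gamma> p"
  using aniso unfolding anisotropy_def by blast+

lemma anisotropy_zero: "\<gamma> 0 = 0"
  using anisotropy_scale[of 2 0] by simp

lemma anisotropy_nonneg: "\<gamma> p \<ge> 0"
  using anisotropy_pos[of p] anisotropy_zero by (cases "p = 0") auto

text \<open>\<open>C2_on\<close> only asserts that some gradient field exists. Uniqueness of
  gradients identifies it with \<open>grad \<gamma>\<close> off the origin, an open set, so its
  derivative carries over.\<close>

lemma anisotropy_second_order:
  obtains H where
    "\<And>p. p \<noteq> 0 \<Longrightarrow> GDERIV \<gamma> p :> grad \<gamma> p"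
    "\<And>p. p \<noteq> 0 \<Longrightarrow> (grad \<gamma> has_derivative (\<lambda>v. H p *v v)) (at p)"
    "continuous_on (UNIV - {0}) H"
proof -
  obtain g H where g: "\<And>p. p \<noteq> 0 \<Longrightarrow> GDERIV \<gamma> p :> g p"
    and H: "\<And>p. p \<noteq> 0 \<Longrightarrow> (g has_derivative (\<lambda>v. H p *v v)) (at p)"
    and cH: "continuous_on (UNIV - {0}) H"
    using aniso unfolding anisotropy_def C2_on_def by (metis DiffI UNIV_I singletonD)
  have eq: "grad \<gamma> p = g p" if "p \<noteq> 0" for p
    using g[OF that] by (rule grad_eqI)
  have "(grad \<gamma> has_derivative (\<lambda>v. H p *v v)) (at p)" if "p \<noteq> 0" for p
    by (rule has_derivative_transform_within_open[OF H[OF that], of "UNIV - {0}"])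
       (use that eq in auto)
  with g eq cH show thesis by (metis that)
qed

text \<open>Euler's identity: both sides are the derivative of
  \<open>\<gamma> (t *\<^sub>R p)\<close> at \<open>t = 1\<close>, once by the chain rule and once
  by homogeneity.\<close>

lemma grad_inner_self:
  assumes "p \<noteq> 0"
  shows "grad \<gamma> p \<bullet> p = \<gamma> p"
proof -
  obtain H where "GDERIV \<gamma> p :> grad \<gamma> p"
    using anisotropy_second_order assms by metis
  then have "(\<gamma> has_derivative (\<lambda>h. h \<bullet> grad \<gamma> p)) (at (1 *\<^sub>R p))"
    by (simp add: gderiv_def)
  moreover have "((\<lambda>t. t *\<^sub>R p) has_derivative (\<lambda>t. t *\<^sub>R p)) (at (1::real))"
    by (auto intro!: derivative_eq_intros)
  ultimately have "((\<lambda>t. \<gamma> (t *\<^sub>R p)) has_derivative (\<lambda>t. (t *\<^sub>R p) \<bullet> grad \<gamma> p)) (at (1::real))"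
    by (rule has_derivative_compose[rotated])
  then have "((\<lambda>t. \<gamma> (t *\<^sub>R p)) has_real_derivative p \<bullet> grad \<gamma> p) (at 1)"
    by (simp add: has_field_derivative_def mult_commute_abs)
  moreover have "((\<lambda>t. t * \<gamma> p) has_real_derivative \<gamma> p) (at 1)"
    by (auto intro!: derivative_eq_intros)
  \<comment> \<open>Homogeneity holds for positive factors only; radius 1 about 1 keeps
    \<open>t\<close> positive.\<close>
  then have "((\<lambda>t. \<gamma> (t *\<^sub>R p)) has_real_derivative \<gamma> p) (at 1)"
    by (rule has_field_derivative_transform_within[of _ _ _ _ 1])
       (auto simp: dist_real_def anisotropy_scale)
  ultimately show ?thesis
    using DERIV_unique by (metis inner_commute)
qed

text \<open>Taylor's theorem along the tangent line of the circle at \<open>n\<close>. The segment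
  stays in the annulus between radii 1 and 2, compact and away from the origin, so one bound on the
  second derivative serves all \<open>n\<close> and \<open>\<tau>\<close>.\<close>

lemma anisotropy_taylor_bound:
  obtains C where "C \<ge> 0"
    "\<And>n \<tau> t. norm n = 1 \<Longrightarrow> norm \<tau> = 1 \<Longrightarrow> n \<bullet> \<tau> = 0 \<Longrightarrow> \<bar>t\<bar> \<le> 1 \<Longrightarrow>
      \<gamma> (n + t *\<^sub>R \<tau>) \<le> \<gamma> n + t * (grad \<gamma> n \<bullet> \<tau>) + C * t\<^sup>2"
proof -
  obtain H where D: "\<And>p. p \<noteq> 0 \<Longrightarrow> GDERIV \<gamma> p :> grad \<gamma> p"
    and D2: "\<And>p. p \<noteq> 0 \<Longrightarrow> (grad \<gamma> has_derivative (\<lambda>v. H p *v v)) (at p)"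
    and cH: "continuous_on (UNIV - {0}) H"
    using anisotropy_second_order by blast
  define A where "A = (cball 0 2 - ball 0 1 :: (real^2) set)"
  have "continuous_on (A \<times> sphere 0 1) (\<lambda>z. H (fst z))"
    by (rule continuous_on_compose2[OF cH]) (auto simp: A_def intro: continuous_intros)
  then have "continuous_on (A \<times> sphere 0 1) (\<lambda>z. snd z \<bullet> (H (fst z) *v snd z))"
    by (simp add: matrix_vector_mult_def inner_vec_def sum_2) (intro continuous_intros)
  moreover have "compact (A \<times> sphere (0::real^2) 1)"
    by (auto simp: A_def intro!: compact_Times compact_diff)
  ultimately have "bounded ((\<lambda>z. snd z \<bullet> (H (fst z) *v snd z)) ` (A \<times> sphere 0 1))"
    using compact_continuous_image compact_imp_bounded by blast
  then obtain B where B: "B > 0" "\<And>p v. p \<in> A \<Longrightarrow> norm v = 1 \<Longrightarrow> \<bar>v \<bullet> (H p *v v)\<bar> \<le> B"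
    unfolding bounded_pos by force
  have "\<gamma> (n + t *\<^sub>R \<tau>) \<le> \<gamma> n + t * (grad \<gamma> n \<bullet> \<tau>) + B * t\<^sup>2"
    if n: "norm n = 1" and \<tau>: "norm \<tau> = 1" and orth: "n \<bullet> \<tau> = 0" and t: "\<bar>t\<bar> \<le> 1" for n \<tau> t
  \<comment> \<open>Taylor's theorem requires \<open>t\<close> to differ from the point of
    expansion.\<close>
  proof (cases "t = 0")
    case False
    let ?p = "\<lambda>s. n + s *\<^sub>R \<tau>"
    have np: "(norm (?p s))\<^sup>2 = 1 + s\<^sup>2" for s
      using n \<tau> orth
      by (simp add: power2_norm_eq_inner inner_add_left inner_add_right inner_commute norm_eq_1)
        (simp add: power2_eq_square)
    have A: "?p s \<in> A" if "\<bar>s\<bar> \<le> 1" for s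
    proof -
      have "s\<^sup>2 \<le> 1" using that by (simp add: abs_square_le_1)
      then have "(norm (?p s))\<^sup>2 \<le> 2\<^sup>2" "1\<^sup>2 \<le> (norm (?p s))\<^sup>2" using np[of s] by auto
      then have "norm (?p s) \<le> 2" "1 \<le> norm (?p s)"
        using power2_le_imp_le[of "norm (?p s)" 2] power2_le_imp_le[of 1 "norm (?p s)"] by auto
      then show ?thesis by (auto simp: A_def)
    qed
    have nz: "?p s \<noteq> 0" for s
      using np[of s] sum_power2_gt_zero_iff[of 1 s] by auto
    \<comment> \<open>The restriction of \<open>\<gamma>\<close> to the line, followed by its first
      and second derivatives.\<close>
    define d where "d = (\<lambda>m. if m = 0 then (\<lambda>s. \<gamma> (?p s))
        else if m = (1::nat) then (\<lambda>s. \<tau> \<bullet> grad \<gamma> (?p s)) else (\<lambda>s. \<tau> \<bullet> (H (?p s) *v \<tau>)))"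
    have dp: "(?p has_derivative (\<lambda>h. h *\<^sub>R \<tau>)) (at s)" for s
      by (auto intro!: derivative_eq_intros)
    have "(d 0 has_real_derivative d 1 s) (at s)" for s
    proof -
      have "((\<lambda>s. \<gamma> (?p s)) has_derivative (\<lambda>h. (h *\<^sub>R \<tau>) \<bullet> grad \<gamma> (?p s))) (at s)"
        by (rule has_derivative_compose[OF dp]) (use D[OF nz[of s]] in \<open>simp add: gderiv_def\<close>)
      then show ?thesis
        by (simp add: d_def has_field_derivative_def mult_commute_abs)
    qed
    moreover have "(d 1 has_real_derivative d 2 s) (at s)" for s
    proof -
      have "((\<lambda>s. grad \<gamma> (?p s)) has_derivative (\<lambda>h. H (?p s) *v (h *\<^sub>R \<tau>))) (at s)"
        by (rule has_derivative_compose[OF dp D2[OF nz[of s]]])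
      then have "((\<lambda>s. \<tau> \<bullet> grad \<gamma> (?p s)) has_derivative (\<lambda>h. \<tau> \<bullet> (H (?p s) *v (h *\<^sub>R \<tau>)))) (at s)"
        by (rule has_derivative_inner_right)
      then show ?thesis
        by (simp add: d_def has_field_derivative_def scaleR_matrix_vector_assoc[symmetric] mult_commute_abs matrix_vector_mult_scaleR)
    qed
    ultimately have "\<forall>m s. m < 2 \<and> -1 \<le> s \<and> s \<le> 1 \<longrightarrow> (d m has_real_derivative d (Suc m) s) (at s)"
      by (metis less_2_cases_iff Suc_1 One_nat_def)
    then have "\<exists>s. (if t < 0 then t < s \<and> s < 0 else 0 < s \<and> s < t) \<and>
        d 0 t = (\<Sum>m<2. d m 0 / fact m * (t - 0)^m) + d 2 s / fact 2 * (t - 0)^2"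
      using t False by (intro Taylor[of 2 d "d 0" "-1" 1 0 t]) auto
    then obtain s where s: "if t < 0 then t < s \<and> s < 0 else 0 < s \<and> s < t"
      and eq: "d 0 t = (\<Sum>m<2. d m 0 / fact m * (t - 0)^m) + d 2 s / fact 2 * (t - 0)^2"
      by blast
    have "\<gamma> (?p t) = \<gamma> n + t * (grad \<gamma> n \<bullet> \<tau>) + d 2 s / 2 * t\<^sup>2"
      using eq by (simp add: d_def numeral_2_eq_2 inner_commute)
    moreover have "d 2 s / 2 \<le> B"
      using B(2)[OF A[of s] \<tau>] B(1) s t by (auto simp: d_def split: if_splits)
    ultimately show ?thesis
      by (smt (verit, best) mult_right_mono zero_le_power2)
  qed simp
  with B(1) that show thesis by (metis less_imp_le)
qed

lemma anisotropy_bounds: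
  obtains m M C\<^sub>1 where "m > 0" "C\<^sub>1 \<ge> 0"
    "\<And>n. norm n = 1 \<Longrightarrow> m \<le> \<gamma> n" "\<And>n. norm n = 1 \<Longrightarrow> \<gamma> n \<le> M"
    "\<And>n \<tau>. norm n = 1 \<Longrightarrow> norm \<tau> = 1 \<Longrightarrow> \<bar>grad \<gamma> n \<bullet> \<tau>\<bar> \<le> C\<^sub>1"
proof -
  have cpt: "compact (sphere (0::real^2) 1)" and ne: "sphere (0::real^2) 1 \<noteq> {}" by auto
  have c: "continuous_on (sphere 0 1) \<gamma>"
    using aniso continuous_on_subset unfolding anisotropy_def by blast
  obtain H where "\<And>p. p \<noteq> 0 \<Longrightarrow> (grad \<gamma> has_derivative (\<lambda>v. H p *v v)) (at p)"
    using anisotropy_second_order by metis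
  then have "continuous_on (sphere 0 1) (grad \<gamma>)"
    by (intro continuous_at_imp_continuous_on ballI) (metis has_derivative_continuous norm_zero mem_sphere_0 zero_neq_one)
  then have "bounded (grad \<gamma> ` sphere 0 1)"
    using cpt compact_continuous_image compact_imp_bounded by blast
  then obtain C\<^sub>1 where C: "C\<^sub>1 > 0" "\<And>n. norm n = 1 \<Longrightarrow> norm (grad \<gamma> n) \<le> C\<^sub>1"
    unfolding bounded_pos by auto
  have "\<bar>grad \<gamma> n \<bullet> \<tau>\<bar> \<le> C\<^sub>1" if "norm n = 1" "norm \<tau> = 1" for n \<tau>
    using Cauchy_Schwarz_ineq2[of "grad \<gamma> n" \<tau>] C(2)[OF that(1)] that(2) by simp
  moreover obtain a where a: "norm a = 1" "\<And>n. norm n = 1 \<Longrightarrow> \<gamma> a \<le> \<gamma> n"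
    using continuous_attains_inf[OF cpt ne c] by auto
  moreover obtain b where "\<And>n. norm n = 1 \<Longrightarrow> \<gamma> n \<le> \<gamma> b"
    using continuous_attains_sup[OF cpt ne c] by (metis mem_sphere_0)
  moreover have "\<gamma> a > 0" using a(1) by (intro anisotropy_pos) auto
  ultimately show thesis using that[of "\<gamma> a" C\<^sub>1 "\<gamma> b"] C(1) by auto
qed

end

section \<open>The stabilizing threshold, by comparison with quadratic forms\<close>

lemma quadratic_form_nonneg:
  fixes p q s x y :: real
  assumes "p > 0" "q\<^sup>2 \<le> p * s"
  shows "0 \<le> p * x\<^sup>2 - 2 * q * x * y + s * y\<^sup>2"
proof -
  \<comment> \<open>Completing the square in \<open>p\<close> times the form; the discriminant
    decides the sign.\<close>
  have "0 \<le> (p * x - q * y)\<^sup>2 + (p * s - q\<^sup>2) * y\<^sup>2"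
    using assms(2) by (intro add_nonneg_nonneg mult_nonneg_nonneg) auto
  also have "\<dots> = p * (p * x\<^sup>2 - 2 * q * x * y + s * y\<^sup>2)"
    by (simp add: power2_eq_square algebra_simps)
  finally show ?thesis using assms(1) by (simp add: zero_le_mult_iff)
qed

text \<open>Homogeneity carries the bound along the ray through
  \<open>n + (b / a) *\<^sub>R \<tau>\<close>. The quadratic error becomes
  \<open>C * b\<^sup>2 / a\<close>, which is under control where \<open>a\<close> is bounded below
  or dominates \<open>b\<close>.\<close>

lemma anisotropy_near_ray:
  assumes aniso: "anisotropy \<gamma>"
    and bound: "\<gamma> (n + (b / a) *\<^sub>R \<tau>) \<le> \<gamma> n + b / a * G + C * (b / a)\<^sup>2" and "a > 0"
  shows "\<gamma> (a *\<^sub>R n + b *\<^sub>R \<tau>) \<le> a * \<gamma> n + b * G + C * b\<^sup>2 / a"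
proof -
  have "\<gamma> (a *\<^sub>R n + b *\<^sub>R \<tau>) = \<gamma> (a *\<^sub>R (n + (b / a) *\<^sub>R \<tau>))"
    using assms(3) by (simp add: scaleR_add_right)
  also have "\<dots> = a * \<gamma> (n + (b / a) *\<^sub>R \<tau>)"
    using anisotropy_scale[OF aniso] assms(3) by blast
  also have "\<dots> \<le> a * (\<gamma> n + b / a * G + C * (b / a)\<^sup>2)"
    using bound assms(3) by (intro mult_left_mono) auto
  also have "\<dots> = a * \<gamma> n + b * G + C * b\<^sup>2 / a"
    using assms(3) by (simp add: field_simps power2_eq_square)
  finally show ?thesis .
qed

text \<open>The right-hand side is \<open>Z\<^sub>k(n) y \<bullet> (y - \<tau>)\<close> for \<open>n = -\<tau>\<^sup>\<bottom>\<close> and \<open>y = a \<tau> - b n\<close>, so that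
  \<open>-y\<^sup>\<bottom> = a n + b \<tau>\<close>.\<close>

lemma anisotropy_stabilized:
  assumes aniso: "anisotropy \<gamma>"
    and sym: "\<forall>n\<in>sphere 0 1. \<gamma> (- n) < 3 * \<gamma> n"
  obtains k\<^sub>0 where "\<And>n \<tau> a b k. norm n = 1 \<Longrightarrow> norm \<tau> = 1 \<Longrightarrow> n \<bullet> \<tau> = 0 \<Longrightarrow> k\<^sub>0 \<le> k \<Longrightarrow>
    \<gamma> (a *\<^sub>R n + b *\<^sub>R \<tau>) - \<gamma> n
      \<le> \<gamma> n * (a * (a - 1)) + (grad \<gamma> n \<bullet> \<tau>) * b * (2 * a - 1) + (k - \<gamma> n) * b\<^sup>2"
proof -
  obtain C where C: "C \<ge> 0" and taylor:
    "\<And>n \<tau> t. norm n = 1 \<Longrightarrow> norm \<tau> = 1 \<Longrightarrow> n \<bullet> \<tau> = 0 \<Longrightarrow> \<bar>t\<bar> \<le> 1 \<Longrightarrow>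
      \<gamma> (n + t *\<^sub>R \<tau>) \<le> \<gamma> n + t * (grad \<gamma> n \<bullet> \<tau>) + C * t\<^sup>2"
    using anisotropy_taylor_bound[OF aniso] by metis
  obtain m M C1 where m: "m > 0" and C1: "C1 \<ge> 0"
    and lower: "\<And>n. norm n = 1 \<Longrightarrow> m \<le> \<gamma> n" and upper: "\<And>n. norm n = 1 \<Longrightarrow> \<gamma> n \<le> M"
    and grad: "\<And>n \<tau>. norm n = 1 \<Longrightarrow> norm \<tau> = 1 \<Longrightarrow> \<bar>grad \<gamma> n \<bullet> \<tau>\<bar> \<le> C1"
    using anisotropy_bounds[OF aniso] by metis
  have M: "M > 0" using m lower[of "axis 1 1"] upper[of "axis 1 1"] by simp
  have cont: "continuous_on UNIV \<gamma>" using aniso unfolding anisotropy_def by blast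
  have "continuous_on (sphere 0 1) (\<lambda>n. 3 * \<gamma> n - \<gamma> (- n))"
    by (intro continuous_intros continuous_on_compose2[OF cont]) auto
  then obtain n0 where n0: "n0 \<in> sphere 0 1"
    "\<And>n. norm n = 1 \<Longrightarrow> 3 * \<gamma> n0 - \<gamma> (- n0) \<le> 3 * \<gamma> n - \<gamma> (- n)"
    using continuous_attains_inf[of "sphere 0 1" "\<lambda>n. 3 * \<gamma> n - \<gamma> (- n)"] by auto
  \<comment> \<open>Compactness of the circle turns the strict inequality into a uniform
    gap.\<close>
  define \<epsilon> where "\<epsilon> = 3 * \<gamma> n0 - \<gamma> (- n0)"
  have \<epsilon>: "\<epsilon> > 0" using sym n0(1) by (auto simp: \<epsilon>_def)
  have \<epsilon>_le: "\<gamma> (- n) \<le> 3 * \<gamma> n - \<epsilon>" if "norm n = 1" for n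
    using n0(2)[OF that] by (simp add: \<epsilon>_def)
  \<comment> \<open>\<open>C2\<close> is a Lipschitz constant in the direction of
    \<open>\<tau>\<close>, and \<open>c\<close> the coercivity constant on the line
    \<open>b = 0\<close> for \<open>a \<le> 1/2\<close>. In \<open>k0\<close>, \<open>M\<close>
    absorbs \<open>\<gamma> n\<close>; \<open>2 * C + C1\<^sup>2 / m\<close>,
    \<open>2 * C2 + 2 * C1\<close> and \<open>C4\<^sup>2 / (2 * c)\<close> serve the cases
    \<open>near\<close>, \<open>side\<close> and \<open>behind\<close> below.\<close>
  define C2 where "C2 = C1 + C + 2 * M"
  define c where "c = min (m / 5) (\<epsilon> / 2)"
  define C4 where "C4 = C2 + 2 * C1"
  define k0 where "k0 = M + 2 * C + C1\<^sup>2 / m + 2 * C2 + 2 * C1 + C4\<^sup>2 / (2 * c)"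
  have c: "c > 0" "c \<le> m / 5" "c \<le> \<epsilon> / 2" using m \<epsilon> by (auto simp: c_def)
  have C2: "C2 \<ge> 0" using C C1 M by (simp add: C2_def)
  have C4: "C4 \<ge> 0" using C1 C2 by (simp add: C4_def)
  have "C1\<^sup>2 / m \<ge> 0" "C4\<^sup>2 / (2 * c) \<ge> 0" using m c by auto
  note k0_parts = this C C1 C2
  \<comment> \<open>Comparison with the point at \<open>b = 0\<close>, with no lower bound on
    \<open>a\<close>.\<close>
  have lip: "\<gamma> (a *\<^sub>R n + b *\<^sub>R \<tau>) \<le> \<gamma> (a *\<^sub>R n) + C2 * \<bar>b\<bar>"
    if n: "norm n = 1" and \<tau>: "norm \<tau> = 1" and orth: "n \<bullet> \<tau> = 0" for n \<tau> a b
  proof (cases "\<bar>b\<bar> < \<bar>a\<bar>")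
    case True
    \<comment> \<open>Replacing \<open>n\<close> by \<open>- n\<close> for negative \<open>a\<close>
      allows the expansion along a ray with the positive factor
      \<open>\<bar>a\<bar>\<close>.\<close>
    define s where "s = (if a > 0 then n else - n)"
    have s: "norm s = 1" "s \<bullet> \<tau> = 0" "a *\<^sub>R n = \<bar>a\<bar> *\<^sub>R s" using n orth by (auto simp: s_def)
    have a: "\<bar>a\<bar> > 0" using True by auto
    have "\<gamma> (\<bar>a\<bar> *\<^sub>R s + b *\<^sub>R \<tau>) \<le> \<bar>a\<bar> * \<gamma> s + b * (grad \<gamma> s \<bullet> \<tau>) + C * b\<^sup>2 / \<bar>a\<bar>"
      by (rule anisotropy_near_ray[OF aniso taylor]) (use s \<tau> True a in auto)
    moreover have "C * b\<^sup>2 / \<bar>a\<bar> \<le> C * \<bar>b\<bar>"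
    proof -
      have "b\<^sup>2 \<le> \<bar>b\<bar> * \<bar>a\<bar>"
        using True by (metis abs_ge_zero less_imp_le mult_left_mono power2_abs power2_eq_square)
      then have "C * b\<^sup>2 \<le> C * (\<bar>b\<bar> * \<bar>a\<bar>)" using C by (rule mult_left_mono)
      then show ?thesis using a by (simp add: field_simps)
    qed
    moreover have "b * (grad \<gamma> s \<bullet> \<tau>) \<le> C1 * \<bar>b\<bar>"
    proof -
      have "b * (grad \<gamma> s \<bullet> \<tau>) \<le> \<bar>b\<bar> * \<bar>grad \<gamma> s \<bullet> \<tau>\<bar>" by (metis abs_ge_self abs_mult)
      also have "\<dots> \<le> \<bar>b\<bar> * C1" using grad[OF s(1) \<tau>] by (rule mult_left_mono) simp
      finally show ?thesis by (simp add: mult.commute)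
    qed
    moreover have "\<gamma> (a *\<^sub>R n) = \<bar>a\<bar> * \<gamma> s"
      using anisotropy_scale[OF aniso a] s(3) by simp
    moreover have "M * \<bar>b\<bar> \<ge> 0" using M by simp
    ultimately show ?thesis by (simp add: s(3) C2_def algebra_simps)
  next
    case False
    let ?p = "a *\<^sub>R n + b *\<^sub>R \<tau>"
    \<comment> \<open>Here \<open>b\<close> dominates \<open>a\<close>, so the whole value of
      \<open>\<gamma>\<close>, and not just its increment, is bounded by a multiple of
      \<open>\<bar>b\<bar>\<close>.\<close>
    have "\<gamma> ?p \<le> M * norm ?p"
    proof (cases "?p = 0")
      case False
      have "\<gamma> ?p = norm ?p * \<gamma> (sgn ?p)"
        using anisotropy_scale[OF aniso, of "norm ?p" "sgn ?p"] False by (simp add: sgn_div_norm)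
      also have "\<dots> \<le> norm ?p * M"
        using upper[of "sgn ?p"] False by (intro mult_left_mono) (auto simp: norm_sgn)
      finally show ?thesis by (simp add: mult.commute)
    qed (simp add: anisotropy_zero[OF aniso])
    also have "\<dots> \<le> M * (2 * \<bar>b\<bar>)"
      using False M n \<tau> norm_triangle_ineq[of "a *\<^sub>R n" "b *\<^sub>R \<tau>"] by (intro mult_left_mono) auto
    also have "\<dots> \<le> C2 * \<bar>b\<bar>" using C C1 by (simp add: C2_def algebra_simps)
    finally show ?thesis using anisotropy_nonneg[OF aniso, of "a *\<^sub>R n"] by simp
  qed
  have "\<gamma> (a *\<^sub>R n + b *\<^sub>R \<tau>) - \<gamma> n
      \<le> \<gamma> n * (a * (a - 1)) + (grad \<gamma> n \<bullet> \<tau>) * b * (2 * a - 1) + (k - \<gamma> n) * b\<^sup>2"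
    if n: "norm n = 1" and \<tau>: "norm \<tau> = 1" and orth: "n \<bullet> \<tau> = 0" and k: "k0 \<le> k" for n \<tau> a b k
  proof -
    define G where "G = grad \<gamma> n \<bullet> \<tau>"
    have G: "\<bar>G\<bar> \<le> C1" using grad[OF n \<tau>] by (simp add: G_def)
    note bounds = lower[OF n] upper[OF n]
    \<comment> \<open>In \<open>near\<close> the expansion of \<open>\<gamma>\<close> applies; in
      \<open>side\<close> \<open>b\<close> is bounded away from 0 and \<open>k\<close> dominates; in
      \<open>behind\<close> coercivity in \<open>a\<close> is required, and there the gap
      \<open>\<epsilon>\<close> enters.\<close>
    consider (near) "a \<ge> 1/2" "\<bar>b\<bar> \<le> a" | (side) "a > 1/2" "a < \<bar>b\<bar>" | (behind) "a \<le> 1/2"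
      by linarith
    then have "0 \<le> \<gamma> n * (a\<^sup>2 - a + 1) - \<gamma> (a *\<^sub>R n + b *\<^sub>R \<tau>) + G * b * (2 * a - 1) + (k - \<gamma> n) * b\<^sup>2"
    proof cases
      case near
      have "\<gamma> (a *\<^sub>R n + b *\<^sub>R \<tau>) \<le> a * \<gamma> n + b * G + C * b\<^sup>2 / a"
        unfolding G_def by (rule anisotropy_near_ray[OF aniso taylor]) (use n \<tau> orth near in auto)
      moreover have "C * b\<^sup>2 / a \<le> 2 * C * b\<^sup>2"
      proof -
        have "C * b\<^sup>2 * 1 \<le> C * b\<^sup>2 * (2 * a)" using near C by (intro mult_left_mono) auto
        then show ?thesis using near by (simp add: field_simps)
      qed
      \<comment> \<open>After inserting the expansion, the terms of order zero and one cancel and a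
        form in \<open>a - 1\<close> and \<open>b\<close> is left.\<close>
      moreover have "0 \<le> \<gamma> n * (a - 1)\<^sup>2 - 2 * (- G) * (a - 1) * b + (k - \<gamma> n - 2 * C) * b\<^sup>2"
      proof (rule quadratic_form_nonneg)
        have "(- G)\<^sup>2 \<le> C1\<^sup>2" using G C1 by (metis abs_minus power2_abs power_mono abs_ge_zero)
        also have "\<dots> = m * (C1\<^sup>2 / m)" using m by simp
        also have "\<dots> \<le> \<gamma> n * (k - \<gamma> n - 2 * C)"
          using bounds k0_parts k m by (intro mult_mono) (auto simp: k0_def)
        finally show "(- G)\<^sup>2 \<le> \<gamma> n * (k - \<gamma> n - 2 * C)" .
      qed (use bounds m in auto)
      ultimately show ?thesis by (simp add: power2_eq_square algebra_simps)
    next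
      case side
      have "\<gamma> (a *\<^sub>R n + b *\<^sub>R \<tau>) \<le> a * \<gamma> n + C2 * \<bar>b\<bar>"
        using lip[OF n \<tau> orth, of a b] anisotropy_scale[OF aniso, of a n] side by auto
      \<comment> \<open>Since \<open>\<bar>b\<bar>\<close> exceeds 1/2, terms linear in
        \<open>b\<close> are absorbed into \<open>b\<^sup>2\<close>.\<close>
      moreover have b: "\<bar>b\<bar> \<le> 2 * b\<^sup>2"
        using side mult_right_mono[of "1/2" "\<bar>b\<bar>" "\<bar>b\<bar>"] by (simp add: power2_eq_square)
      then have "C2 * \<bar>b\<bar> \<le> 2 * C2 * b\<^sup>2" using C2 mult_left_mono[OF b C2] by simp
      moreover have "- (2 * C1 * b\<^sup>2) \<le> G * b * (2 * a - 1)"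
      proof -
        have "\<bar>G * b * (2 * a - 1)\<bar> = \<bar>G\<bar> * (\<bar>b\<bar> * \<bar>2 * a - 1\<bar>)" by (simp add: abs_mult)
        also have "\<dots> \<le> C1 * (\<bar>b\<bar> * (2 * \<bar>b\<bar>))"
          using G C1 side by (intro mult_mono) auto
        finally show ?thesis by (simp add: power2_eq_square)
      qed
      moreover have "\<gamma> n * (a - 1)\<^sup>2 \<ge> 0" using bounds m by simp
      moreover have "(2 * C2 + 2 * C1) * b\<^sup>2 \<le> (k - \<gamma> n) * b\<^sup>2"
        using bounds k0_parts k by (intro mult_right_mono) (auto simp: k0_def)
      ultimately show ?thesis by (simp add: power2_eq_square algebra_simps)
    next
      case behind
      \<comment> \<open>Coercivity at \<open>b = 0\<close>. For \<open>a > 0\<close> the right-hand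
        side is \<open>\<gamma> n * (1 - a)\<^sup>2\<close>; for \<open>a \<le> 0\<close> it is at
        least \<open>\<gamma> n * (1 + a)\<^sup>2 - a * \<epsilon>\<close>, so that at
        \<open>a = -1\<close> only the gap remains.\<close>
      have "c * (1 + a\<^sup>2) \<le> \<gamma> n * (a\<^sup>2 - a + 1) - \<gamma> (a *\<^sub>R n)"
      proof (cases "a > 0")
        case True
        have "a\<^sup>2 \<le> 1/4" using behind True power_mono[of a "1/2" 2] by (simp add: power2_eq_square)
        then have "c * (1 + a\<^sup>2) \<le> m / 5 * (5 / 4)" using c m by (intro mult_mono) auto
        also have "\<dots> = m * (1/2)\<^sup>2" by (simp add: power2_eq_square)
        also have "\<dots> \<le> \<gamma> n * (1 - a)\<^sup>2"
          using bounds m behind True by (intro mult_mono power_mono) auto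
        finally show ?thesis
          using anisotropy_scale[OF aniso True, of n] by (simp add: power2_eq_square algebra_simps)
      next
        case False
        have "\<gamma> (a *\<^sub>R n) = - a * \<gamma> (- n)"
          using anisotropy_scale[OF aniso, of "- a" "- n"] anisotropy_zero[OF aniso] False
          by (cases "a = 0") auto
        also have "\<dots> \<le> - a * (3 * \<gamma> n - \<epsilon>)"
          using \<epsilon>_le[OF n] False by (intro mult_left_mono) auto
        finally have "\<gamma> (a *\<^sub>R n) \<le> - a * (3 * \<gamma> n - \<epsilon>)" .
        moreover have "c * (1 + a)\<^sup>2 \<le> \<gamma> n * (1 + a)\<^sup>2"
          using bounds c m by (intro mult_right_mono) auto
        moreover have "2 * c * (- a) \<le> \<epsilon> * (- a)"
          using c False by (intro mult_right_mono) auto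
        ultimately show ?thesis by (simp add: power2_eq_square algebra_simps)
      qed
      \<comment> \<open>The square of \<open>1 + \<bar>a\<bar>\<close> matches the cross term
        \<open>C4 * (1 + \<bar>a\<bar>) * \<bar>b\<bar>\<close> bounded below.\<close>
      moreover have "c / 2 * (1 + \<bar>a\<bar>)\<^sup>2 \<le> c * (1 + a\<^sup>2)"
      proof -
        have "0 \<le> c / 2 * (1 - \<bar>a\<bar>)\<^sup>2" using c by simp
        then show ?thesis by (simp add: power2_eq_square algebra_simps)
      qed
      moreover have "\<gamma> (a *\<^sub>R n + b *\<^sub>R \<tau>) \<le> \<gamma> (a *\<^sub>R n) + C2 * \<bar>b\<bar>" by (rule lip[OF n \<tau> orth])
      moreover have "- (C1 * \<bar>b\<bar> * (1 + 2 * \<bar>a\<bar>)) \<le> G * b * (2 * a - 1)"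
      proof -
        have "\<bar>G * b * (2 * a - 1)\<bar> = \<bar>G\<bar> * \<bar>b\<bar> * \<bar>2 * a - 1\<bar>" by (simp add: abs_mult)
        also have "\<dots> \<le> C1 * \<bar>b\<bar> * (1 + 2 * \<bar>a\<bar>)"
          using G C1 by (intro mult_mono) auto
        finally show ?thesis by linarith
      qed
      moreover have "C2 * \<bar>b\<bar> + C1 * \<bar>b\<bar> * (1 + 2 * \<bar>a\<bar>) \<le> C4 * (1 + \<bar>a\<bar>) * \<bar>b\<bar>"
      proof -
        have "0 \<le> (C1 + C2 * \<bar>a\<bar>) * \<bar>b\<bar>" using C1 C2 by simp
        then show ?thesis by (simp add: C4_def algebra_simps)
      qed
      \<comment> \<open>The discriminant condition of this form is what fixes the summand
        \<open>C4\<^sup>2 / (2 * c)\<close> of \<open>k0\<close>.\<close>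
      moreover have "0 \<le> c / 2 * (1 + \<bar>a\<bar>)\<^sup>2 - 2 * (C4 / 2) * (1 + \<bar>a\<bar>) * \<bar>b\<bar> + (k - \<gamma> n) * \<bar>b\<bar>\<^sup>2"
      proof (rule quadratic_form_nonneg)
        have "(C4 / 2)\<^sup>2 = c / 2 * (C4\<^sup>2 / (2 * c))" using c by (simp add: power2_eq_square)
        also have "\<dots> \<le> c / 2 * (k - \<gamma> n)"
          using bounds k0_parts k[unfolded k0_def] c by (intro mult_left_mono) linarith+
        finally show "(C4 / 2)\<^sup>2 \<le> c / 2 * (k - \<gamma> n)" .
      qed (use c in simp)
      ultimately show ?thesis by simp
    qed
    then show ?thesis by (simp add: G_def power2_eq_square algebra_simps)
  qed
  with that show thesis by blast
qed

section \<open>Rotation in the plane and \<open>Zmat\<close> in the frame of tangent and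
  normal\<close>

lemma perp_simps [simp]: "perp v $ 1 = v $ 2" "perp v $ 2 = - (v $ 1)"
  by (simp_all add: perp_def)

lemma perp_0 [simp]: "perp 0 = 0"
  by (simp add: vec_eq_iff forall_2)

lemma inner_real2: "u \<bullet> v = u $ 1 * v $ 1 + u $ 2 * v $ 2" for u v :: "real^2"
  by (simp add: inner_vec_def sum_2)

lemma norm_perp [simp]: "norm (perp v) = norm v"
  by (simp add: norm_eq_sqrt_inner inner_real2 add.commute)

lemma perp_orthogonal: "perp v \<bullet> v = 0"
  by (simp add: inner_real2)

lemma perp_scaleR: "perp (c *\<^sub>R v) = c *\<^sub>R perp v"
  by (simp add: vec_eq_iff forall_2)

lemma real2_decompose:
  assumes "norm \<tau> = 1"
  shows "y = (y \<bullet> \<tau>) *\<^sub>R \<tau> + (y \<bullet> perp \<tau>) *\<^sub>R perp \<tau>"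
proof -
  have "\<tau> $ 1 * \<tau> $ 1 + \<tau> $ 2 * \<tau> $ 2 = 1"
    using assms by (simp add: norm_eq_1 inner_real2)
  then have "y $ 1 = (y \<bullet> \<tau>) * \<tau> $ 1 + (y \<bullet> perp \<tau>) * \<tau> $ 2"
    "y $ 2 = (y \<bullet> \<tau>) * \<tau> $ 2 - (y \<bullet> perp \<tau>) * \<tau> $ 1"
    unfolding inner_real2 perp_simps by algebra+
  then show ?thesis by (simp add: vec_eq_iff forall_2)
qed

lemma Zmat_mult_vec:
  "Zmat \<gamma> k n *v y =
    \<gamma> n *\<^sub>R y - (grad \<gamma> n \<bullet> y) *\<^sub>R n - (n \<bullet> y) *\<^sub>R grad \<gamma> n + (k n * (n \<bullet> y)) *\<^sub>R n"
  by (simp add: Zmat_def outer_def vec_eq_iff forall_2 matrix_vector_mult_def mat_def sum_2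
      inner_real2 algebra_simps)

text \<open>Euler's identity evaluates the normal component of the gradient, so only its tangential
  component remains, and the coefficient of \<open>b\<^sup>2\<close> is
  \<open>k n - \<gamma> n\<close>.\<close>

lemma Zmat_inner_orthonormal:
  assumes aniso: "anisotropy \<gamma>" and \<tau>: "norm \<tau> = 1" and n: "n = - perp \<tau>"
  shows "(Zmat \<gamma> k n *v (a *\<^sub>R \<tau> - b *\<^sub>R n)) \<bullet> (a *\<^sub>R \<tau> - b *\<^sub>R n - \<tau>) =
    \<gamma> n * (a * (a - 1)) + (grad \<gamma> n \<bullet> \<tau>) * b * (2 * a - 1) + (k n - \<gamma> n) * b\<^sup>2"
proof -
  have nn: "n \<bullet> n = 1" "\<tau> \<bullet> \<tau> = 1" "n \<bullet> \<tau> = 0" "\<tau> \<bullet> n = 0"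
    using \<tau> by (simp_all add: n flip: norm_eq_1) (simp_all add: inner_real2)
  have "grad \<gamma> n \<bullet> n = \<gamma> n"
    using nn by (intro grad_inner_self[OF aniso]) auto
  then show ?thesis
    unfolding Zmat_mult_vec
    by (simp add: inner_diff_left inner_diff_right inner_add_left inner_add_right nn
        inner_commute[of _ "grad \<gamma> n"] algebra_simps power2_eq_square)
qed

text \<open>Dividing \<open>x\<close> and \<open>y\<close> by \<open>norm x\<close> reduces to a
  unit tangent, where \<open>anisotropy_stabilized\<close> applies; both sides scale
  linearly.\<close>

lemma anisotropy_energy_step:
  assumes aniso: "anisotropy \<gamma>"
    and sym: "\<forall>n\<in>sphere 0 1. \<gamma> (- n) < 3 * \<gamma> n"
  obtains k\<^sub>0 where "\<And>k x y n. (\<forall>n\<in>sphere 0 1. k\<^sub>0 \<le> k n) \<Longrightarrow> x \<noteq> 0 \<Longrightarrow>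
    n = - ((1 / norm x) *\<^sub>R perp x) \<Longrightarrow>
    \<gamma> (- ((1 / norm y) *\<^sub>R perp y)) * norm y - \<gamma> n * norm x
      \<le> (Zmat \<gamma> k n *v y) \<bullet> (inverse (norm x) *\<^sub>R (y - x))"
proof -
  obtain k0 where k0: "\<And>n \<tau> a b k. norm n = 1 \<Longrightarrow> norm \<tau> = 1 \<Longrightarrow> n \<bullet> \<tau> = 0 \<Longrightarrow> k0 \<le> k \<Longrightarrow>
    \<gamma> (a *\<^sub>R n + b *\<^sub>R \<tau>) - \<gamma> n
      \<le> \<gamma> n * (a * (a - 1)) + (grad \<gamma> n \<bullet> \<tau>) * b * (2 * a - 1) + (k - \<gamma> n) * b\<^sup>2"
    using anisotropy_stabilized[OF aniso sym] by metis
  have "\<gamma> (- ((1 / norm y) *\<^sub>R perp y)) * norm y - \<gamma> n * norm x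
      \<le> (Zmat \<gamma> k n *v y) \<bullet> (inverse (norm x) *\<^sub>R (y - x))"
    if k: "\<forall>n\<in>sphere 0 1. k0 \<le> k n" and x: "x \<noteq> 0" and n: "n = - ((1 / norm x) *\<^sub>R perp x)"
    for k x y n
  proof -
    define l where "l = norm x"
    define \<tau> where "\<tau> = (1 / l) *\<^sub>R x"
    define z where "z = (1 / l) *\<^sub>R y"
    have l: "l > 0" using x by (simp add: l_def)
    have \<tau>: "norm \<tau> = 1" using x by (simp add: \<tau>_def l_def)
    have n': "n = - perp \<tau>" by (simp add: n \<tau>_def l_def perp_scaleR)
    have nn: "norm n = 1" "n \<bullet> \<tau> = 0" using \<tau> by (simp_all add: n' perp_orthogonal)
    define a where "a = z \<bullet> \<tau>"
    define b where "b = z \<bullet> perp \<tau>"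
    have z: "z = a *\<^sub>R \<tau> - b *\<^sub>R n"
      using real2_decompose[OF \<tau>, of z] by (simp add: a_def b_def n')
    have y: "y = l *\<^sub>R z" and x': "x = l *\<^sub>R \<tau>" using l by (simp_all add: z_def \<tau>_def)
    \<comment> \<open>An element of the new curve may collapse: for \<open>y = 0\<close> both sides
      vanish because \<open>\<gamma> 0 = 0\<close>.\<close>
    have "\<gamma> (- ((1 / norm y) *\<^sub>R perp y)) * norm y = \<gamma> (- perp y)"
      using anisotropy_scale[OF aniso, of "norm y" "- ((1 / norm y) *\<^sub>R perp y)"]
        anisotropy_zero[OF aniso] by (cases "y = 0") auto
    also have "- perp y = l *\<^sub>R (a *\<^sub>R n + b *\<^sub>R \<tau>)"
      by (simp add: y z n' vec_eq_iff forall_2 algebra_simps)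
    finally have 1: "\<gamma> (- ((1 / norm y) *\<^sub>R perp y)) * norm y = l * \<gamma> (a *\<^sub>R n + b *\<^sub>R \<tau>)"
      using anisotropy_scale[OF aniso l] by simp
    have "Zmat \<gamma> k n *v y = l *\<^sub>R (Zmat \<gamma> k n *v z)"
      by (simp add: y matrix_vector_mult_scaleR)
    then have "(Zmat \<gamma> k n *v y) \<bullet> (inverse (norm x) *\<^sub>R (y - x)) = l * ((Zmat \<gamma> k n *v z) \<bullet> (z - \<tau>))"
      using l unfolding l_def[symmetric] by (simp add: y x' flip: scaleR_diff_right)
    also have "(Zmat \<gamma> k n *v z) \<bullet> (z - \<tau>) =
        \<gamma> n * (a * (a - 1)) + (grad \<gamma> n \<bullet> \<tau>) * b * (2 * a - 1) + (k n - \<gamma> n) * b\<^sup>2"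
      unfolding z by (rule Zmat_inner_orthonormal[OF aniso \<tau> n'])
    finally show ?thesis
      using mult_left_mono[OF k0[OF nn(1) \<tau> nn(2), of "k n" a b], of l] k nn l 1
      by (simp add: l_def[symmetric] algebra_simps)
  qed
  with that show thesis by blast
qed

section \<open>Piecewise affine functions\<close>

text \<open>The constant derivative on the element that ends at node \<open>j\<close>, written with
  nodal values so that scalar and vector functions are treated alike.\<close>

definition slope :: "nat \<Rightarrow> (real \<Rightarrow> 'a::real_vector) \<Rightarrow> nat \<Rightarrow> 'a" where
  "slope N f j = real N *\<^sub>R (f (node N j) - f (node N (j - 1)))"

lemma node_mono: "i \<le> j \<Longrightarrow> node N i \<le> node N j"
  by (simp add: node_def divide_right_mono)

lemma node_0 [simp]: "node N 0 = 0"
  and node_N: "N \<ge> 1 \<Longrightarrow> node N N = 1"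
  by (simp_all add: node_def)

lemma node_diff: "j \<ge> 1 \<Longrightarrow> node N j - node N (j - 1) = 1 / real N"
  by (simp add: node_def of_nat_diff diff_divide_distrib)

lemma node_less: "N \<ge> 1 \<Longrightarrow> j \<ge> 1 \<Longrightarrow> node N (j - 1) < node N j"
  using node_diff[of j N] by (smt (verit) divide_pos_pos of_nat_0_less_iff zero_less_one less_le_trans)

lemma element_subset: "N \<ge> 1 \<Longrightarrow> j \<in> {1..N} \<Longrightarrow> {node N (j-1)..node N j} \<subseteq> {0..1}"
  using node_mono[of 0 "j - 1" N] node_mono[of j N N] by (auto simp: node_N)

lemma Vh_affine:
  assumes "f \<in> Vh N" "j \<in> {1..N}" "x \<in> {node N (j-1)..node N j}"
  shows "f x = f (node N (j - 1)) + (x - node N (j - 1)) * slope N f j"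
proof -
  obtain a b where ab: "\<And>x. x \<in> {node N (j-1)..node N j} \<Longrightarrow> f x = a * x + b"
    using assms unfolding Vh_def by blast
  have N: "N \<ge> 1" "j \<ge> 1" using assms by auto
  have "f (node N j) - f (node N (j - 1)) = a * (node N j - node N (j - 1))"
    using node_less[OF N] by (simp add: ab algebra_simps)
  then have "slope N f j = a"
    using N node_diff[OF N(2), of N] by (simp add: slope_def)
  then show ?thesis using ab[OF assms(3)] node_less[OF N] by (simp add: ab algebra_simps)
qed

lemma Vh2_affine:
  assumes "f \<in> Vh2 N" "j \<in> {1..N}" "x \<in> {node N (j-1)..node N j}"
  shows "f x = f (node N (j - 1)) + (x - node N (j - 1)) *\<^sub>R slope N f j"
proof -
  have "(\<lambda>x. f x $ i) \<in> Vh N" for i using assms(1) by (simp add: Vh2_def)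
  from Vh_affine[OF this assms(2,3)] show ?thesis
    by (simp add: vec_eq_iff slope_def)
qed

lemma drho_affine:
  fixes f :: "real \<Rightarrow> 'a::real_normed_vector"
  assumes "\<And>x. x \<in> {p..q} \<Longrightarrow> f x = c + (x - p) *\<^sub>R s" "\<rho> \<in> {p<..<q}"
  shows "drho f \<rho> = s"
proof -
  have "((\<lambda>x. c + (x - p) *\<^sub>R s) has_vector_derivative s) (at \<rho>)"
    by (auto intro!: derivative_eq_intros)
  then have "(f has_vector_derivative s) (at \<rho>)"
    by (rule has_vector_derivative_transform_within_open[of _ _ _ "{p<..<q}"])
       (use assms in auto)
  then show ?thesis unfolding drho_def by (rule vector_derivative_at)
qed

lemma drho_Vh: "f \<in> Vh N \<Longrightarrow> j \<in> {1..N} \<Longrightarrow> \<rho> \<in> {node N (j-1)<..<node N j} \<Longrightarrow> drho f \<rho> = slope N f j"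
  by (rule drho_affine[OF Vh_affine[of f N j, folded real_scaleR_def]])

lemma drho_Vh2: "f \<in> Vh2 N \<Longrightarrow> j \<in> {1..N} \<Longrightarrow> \<rho> \<in> {node N (j-1)<..<node N j} \<Longrightarrow> drho f \<rho> = slope N f j"
  by (rule drho_affine[OF Vh2_affine])

lemma Vh2_continuous: "f \<in> Vh2 N \<Longrightarrow> continuous_on {0..1} f"
  unfolding Vh2_def Vh_def by (subst continuous_on_componentwise) (auto simp: Basis_vec_def inner_axis)

section \<open>Integrals and lumped products as finite sums over elements\<close>

lemma integral_piecewise_const:
  fixes c :: "nat \<Rightarrow> real"
  assumes N: "N \<ge> 1"
    and f: "\<And>j \<rho>. j \<in> {1..N} \<Longrightarrow> \<rho> \<in> {node N (j-1)<..<node N j} \<Longrightarrow> f \<rho> = c j"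
  shows "integral {0..1} f = (\<Sum>j=1..N. c j) / real N"
proof -
  have "(f has_integral ((\<Sum>j=1..k. c j) / real N)) {0..node N k}" if "k \<le> N" for k
    using that
  proof (induction k)
    case (Suc k)
    let ?a = "node N k" and ?b = "node N (Suc k)"
    have ab: "?a \<le> ?b" by (rule node_mono) simp
    have "((\<lambda>_. c (Suc k)) has_integral (?b - ?a) * c (Suc k)) {?a..?b}"
      using has_integral_const_real[of "c (Suc k)" ?a ?b] ab by simp
    \<comment> \<open>Nothing is known about \<open>f\<close> at the two nodes, but a finite set
      does not affect the integral.\<close>
    then have "(f has_integral (?b - ?a) * c (Suc k)) {?a..?b}"
      by (rule has_integral_spike_finite[of "{?a, ?b}", rotated 2]) (use f[of "Suc k"] Suc.prems in auto)
    then have "(f has_integral (c (Suc k) / real N)) {?a..?b}"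
      using node_diff[of "Suc k" N] by simp
    from has_integral_combine[OF _ ab Suc.IH this] show ?case
      using Suc.prems node_mono[of 0 k N] by (simp add: add_divide_distrib)
  qed (simp add: has_integral_refl)
  from this[of N] show ?thesis using N by (simp add: node_N integral_unique)
qed

lemma lumped_eq:
  assumes "\<And>j. j \<in> {1..N} \<Longrightarrow> ((\<lambda>\<rho>. u \<rho> \<bullet> v \<rho>) \<longlongrightarrow> B j) (at_left (node N j))"
    and "\<And>j. j \<in> {1..N} \<Longrightarrow> ((\<lambda>\<rho>. u \<rho> \<bullet> v \<rho>) \<longlongrightarrow> A j) (at_right (node N (j - 1)))"
  shows "lumped N u v = (\<Sum>j=1..N. B j + A j) / (2 * real N)"
proof -
  have "Lim (at_left (node N j)) (\<lambda>\<rho>. u \<rho> \<bullet> v \<rho>) + Lim (at_right (node N (j-1))) (\<lambda>\<rho>. u \<rho> \<bullet> v \<rho>) = B j + A j"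
    if "j \<in> {1..N}" for j
    using tendsto_Lim[OF _ assms(1)[OF that]] tendsto_Lim[OF _ assms(2)[OF that]] by simp
  then show ?thesis unfolding lumped_def by simp
qed

text \<open>Jumps at the nodes are encoded by one continuous representative \<open>g j\<close> per
  element; the one-sided limits are then its values at the two ends.\<close>

lemma lumped_piecewise_continuous:
  fixes u v :: "real \<Rightarrow> 'a::real_inner"
  assumes "N \<ge> 1"
    and eq: "\<And>j \<rho>. j \<in> {1..N} \<Longrightarrow> \<rho> \<in> {node N (j-1)<..<node N j} \<Longrightarrow> u \<rho> \<bullet> v \<rho> = g j \<rho>"
    and cont: "\<And>j. j \<in> {1..N} \<Longrightarrow> continuous_on {0..1} (g j)"
  shows "lumped N u v = (\<Sum>j=1..N. g j (node N j) + g j (node N (j - 1))) / (2 * real N)"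
proof (rule lumped_eq)
  fix j assume j: "j \<in> {1..N}"
  let ?a = "node N (j - 1)" and ?b = "node N j"
  have ab: "?a < ?b" using assms(1) j by (intro node_less) auto
  have c: "continuous_on {?a..?b} (g j)"
    using continuous_on_subset[OF cont[OF j] element_subset[OF assms(1) j]] .
  have "eventually (\<lambda>\<rho>. g j \<rho> = u \<rho> \<bullet> v \<rho>) (at_left ?b)"
    using eventually_at_left_real[OF ab] by eventually_elim (simp add: eq[OF j])
  then show "((\<lambda>\<rho>. u \<rho> \<bullet> v \<rho>) \<longlongrightarrow> g j ?b) (at_left ?b)"
    by (rule Lim_transform_eventually[OF continuous_on_Icc_at_leftD[OF c ab]])
  have "eventually (\<lambda>\<rho>. g j \<rho> = u \<rho> \<bullet> v \<rho>) (at_right ?a)"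
    using eventually_at_right_real[OF ab] by eventually_elim (simp add: eq[OF j])
  then show "((\<lambda>\<rho>. u \<rho> \<bullet> v \<rho>) \<longlongrightarrow> g j ?a) (at_right ?a)"
    by (rule Lim_transform_eventually[OF continuous_on_Icc_at_rightD[OF c ab]])
qed

section \<open>The energy estimate\<close>

lemma slope_diff: "slope N (\<lambda>\<rho>. f \<rho> - g \<rho>) j = slope N f j - slope N g j"
  by (simp add: slope_def algebra_simps)

lemma nondegenerate_slope:
  assumes "nondegenerate N X" "X \<in> Vh2 N" "j \<in> {1..N}"
  shows "slope N X j \<noteq> 0"
proof -
  have "node N (j - 1) < node N j" using assms(3) by (intro node_less) auto
  then obtain \<rho> where "\<rho> \<in> {node N (j-1)<..<node N j}"
    using dense by (metis greaterThanLessThan_iff)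
  then show ?thesis
    using assms drho_Vh2[OF assms(2,3)] unfolding nondegenerate_def by fastforce
qed

lemma energy_eq_sum:
  assumes "N \<ge> 1" "X \<in> Vh2 N"
  shows "energy \<gamma> \<sigma> X cl cr = (\<Sum>j=1..N. \<gamma> (- ((1 / norm (slope N X j)) *\<^sub>R perp (slope N X j)))
    * norm (slope N X j)) / real N - \<sigma> * (cr - cl)"
  unfolding energy_def normal_def
  by (subst integral_piecewise_const[OF assms(1)]) (auto simp: drho_Vh2[OF assms(2)])

text \<open>The normalization of \<open>Gvec\<close> serves this: tested with the displacement of a
  contact point, it returns the arclength increment found in the energy and in the
  dissipation.\<close>

lemma Gvec_inner: "r c' \<noteq> r c \<Longrightarrow> Gvec r c c' \<bullet> (r c' - r c) = c' - c"
  by (simp add: Gvec_def power2_norm_eq_inner)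

text \<open>Gives one \<open>\<delta>\<close> for both equations, with the corrected normal written
  out; the energy and the mass balance start from here.\<close>

lemma scheme_step_equations:
  assumes "scheme_step \<gamma> k \<sigma> \<eta> dt r L N X cl cr Y \<mu> cl' cr'"
  obtains \<delta> where "is_delta_normal N r L X cl cr cl' cr' \<delta>"
    "\<forall>\<phi>\<in>Vh N.
      1 / dt * lumped N (\<lambda>\<rho>. (Y \<rho> - X \<rho>) \<bullet> (normal_half X Y \<rho> + \<delta> \<rho>)) (\<lambda>\<rho>. \<phi> \<rho> * norm (drho X \<rho>))
      + L2ip (drho \<mu>) (\<lambda>\<rho>. drho \<phi> \<rho> * inverse (norm (drho X \<rho>))) = 0"
    "\<forall>\<zeta>\<in>Vtest N r cl cr cl' cr'.
      lumped N (\<lambda>\<rho>. \<mu> \<rho> *\<^sub>R (normal_half X Y \<rho> + \<delta> \<rho>)) (\<lambda>\<rho>. norm (drho X \<rho>) *\<^sub>R \<zeta> \<rho>)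
      - L2ip (\<lambda>\<rho>. Zmat \<gamma> k (normal X \<rho>) *v drho Y \<rho>)
             (\<lambda>\<rho>. inverse (norm (drho X \<rho>)) *\<^sub>R drho \<zeta> \<rho>)
      + \<sigma> * (Gvec r cr cr' \<bullet> \<zeta> 1 - Gvec r cl cl' \<bullet> \<zeta> 0)
      - 1 / (\<eta> * dt) * ((cr' - cr) * (Gvec r cr cr' \<bullet> \<zeta> 1)
                         + (cl' - cl) * (Gvec r cl cl' \<bullet> \<zeta> 0)) = 0"
  using assms unfolding scheme_step_def Let_def
  by (elim conjE exE) (rule that)

text \<open>Testing with \<open>\<mu>\<close> and with \<open>Y - X\<close> produces the same lumped
  product, which is eliminated. The elementwise estimate \<open>est\<close> bounds the remaining
  anisotropic term below by the increment of surface energy.\<close>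

lemma scheme_step_energy:
  assumes est: "\<And>x y n. x \<noteq> 0 \<Longrightarrow> n = - ((1 / norm x) *\<^sub>R perp x) \<Longrightarrow>
      \<gamma> (- ((1 / norm y) *\<^sub>R perp y)) * norm y - \<gamma> n * norm x
        \<le> (Zmat \<gamma> k n *v y) \<bullet> (inverse (norm x) *\<^sub>R (y - x))"
    and N: "N \<ge> 1" and dt: "dt > 0"
    and X: "X \<in> Sh N r cl cr" and nd: "nondegenerate N X"
    and step: "scheme_step \<gamma> k \<sigma> \<eta> dt r L N X cl cr Y \<mu> cl' cr'"
  shows "(energy \<gamma> \<sigma> Y cl' cr' - energy \<gamma> \<sigma> X cl cr) / dt
      + L2ip (\<lambda>\<rho>. (norm (drho \<mu> \<rho>))\<^sup>2) (\<lambda>\<rho>. inverse (norm (drho X \<rho>)))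
      + 1 / \<eta> * (((cr' - cr) / dt)\<^sup>2 + ((cl' - cl) / dt)\<^sup>2) \<le> 0"
proof -
  have ne: "r cl' \<noteq> r cl" "r cr' \<noteq> r cr" and Y: "Y \<in> Sh N r cl' cr'"
    and D: "(\<lambda>\<rho>. Y \<rho> - X \<rho>) \<in> Vtest N r cl cr cl' cr'" and \<mu>: "\<mu> \<in> Vh N"
    using step unfolding scheme_step_def by blast+
  have X2: "X \<in> Vh2 N" and Y2: "Y \<in> Vh2 N" and D2: "(\<lambda>\<rho>. Y \<rho> - X \<rho>) \<in> Vh2 N"
    using X Y D by (auto simp: Sh_def Vtest_def)
  have ends: "X 0 = r cl" "X 1 = r cr" "Y 0 = r cl'" "Y 1 = r cr'"
    using X Y by (auto simp: Sh_def)
  obtain \<delta> where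
    test: "\<forall>\<phi>\<in>Vh N.
      1 / dt * lumped N (\<lambda>\<rho>. (Y \<rho> - X \<rho>) \<bullet> (normal_half X Y \<rho> + \<delta> \<rho>)) (\<lambda>\<rho>. \<phi> \<rho> * norm (drho X \<rho>))
      + L2ip (drho \<mu>) (\<lambda>\<rho>. drho \<phi> \<rho> * inverse (norm (drho X \<rho>))) = 0"
    and test2: "\<forall>\<zeta>\<in>Vtest N r cl cr cl' cr'.
      lumped N (\<lambda>\<rho>. \<mu> \<rho> *\<^sub>R (normal_half X Y \<rho> + \<delta> \<rho>)) (\<lambda>\<rho>. norm (drho X \<rho>) *\<^sub>R \<zeta> \<rho>)
      - L2ip (\<lambda>\<rho>. Zmat \<gamma> k (normal X \<rho>) *v drho Y \<rho>)
             (\<lambda>\<rho>. inverse (norm (drho X \<rho>)) *\<^sub>R drho \<zeta> \<rho>)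
      + \<sigma> * (Gvec r cr cr' \<bullet> \<zeta> 1 - Gvec r cl cl' \<bullet> \<zeta> 0)
      - 1 / (\<eta> * dt) * ((cr' - cr) * (Gvec r cr cr' \<bullet> \<zeta> 1)
                         + (cl' - cl) * (Gvec r cl cl' \<bullet> \<zeta> 0)) = 0"
    by (rule scheme_step_equations[OF step]) (rule that)
  note test_\<mu> = bspec[OF test \<mu>] and test_D = bspec[OF test2 D]
  define \<Lambda> where "\<Lambda> = lumped N (\<lambda>\<rho>. (Y \<rho> - X \<rho>) \<bullet> (normal_half X Y \<rho> + \<delta> \<rho>)) (\<lambda>\<rho>. \<mu> \<rho> * norm (drho X \<rho>))"
  define A where "A = L2ip (\<lambda>\<rho>. (norm (drho \<mu> \<rho>))\<^sup>2) (\<lambda>\<rho>. inverse (norm (drho X \<rho>)))"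
  define B where "B = L2ip (\<lambda>\<rho>. Zmat \<gamma> k (normal X \<rho>) *v drho Y \<rho>)
             (\<lambda>\<rho>. inverse (norm (drho X \<rho>)) *\<^sub>R drho (\<lambda>\<rho>. Y \<rho> - X \<rho>) \<rho>)"
  have "A = L2ip (drho \<mu>) (\<lambda>\<rho>. drho \<mu> \<rho> * inverse (norm (drho X \<rho>)))"
    by (simp add: A_def L2ip_def power2_eq_square mult.assoc)
  then have 1: "\<Lambda> = - dt * A" using test_\<mu> dt by (simp add: \<Lambda>_def field_simps)
  \<comment> \<open>The lumped products of the two equations have the same integrand for these test functions.\<close>
  have "\<Lambda> = lumped N (\<lambda>\<rho>. \<mu> \<rho> *\<^sub>R (normal_half X Y \<rho> + \<delta> \<rho>)) (\<lambda>\<rho>. norm (drho X \<rho>) *\<^sub>R (Y \<rho> - X \<rho>))"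
    by (simp add: \<Lambda>_def lumped_def inner_commute mult_ac)
  then have 2: "\<Lambda> - B + \<sigma> * ((cr' - cr) - (cl' - cl)) - 1 / (\<eta> * dt) * ((cr' - cr)\<^sup>2 + (cl' - cl)\<^sup>2) = 0"
    using test_D by (simp add: B_def ends Gvec_inner ne power2_eq_square)
  define x where "x = slope N X"
  define y where "y = slope N Y"
  define n where "n v = - ((1 / norm v) *\<^sub>R perp v)" for v
  have "B = (\<Sum>j=1..N. (Zmat \<gamma> k (n (x j)) *v y j) \<bullet> (inverse (norm (x j)) *\<^sub>R (y j - x j))) / real N"
    unfolding B_def L2ip_def normal_def
    by (rule integral_piecewise_const[OF N])
       (simp only: drho_Vh2[OF X2] drho_Vh2[OF Y2] drho_Vh2[OF D2] slope_diff x_def y_def n_def)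
  \<comment> \<open>Only slopes of the old curve must be nonzero here; those of \<open>Y\<close> are
    unrestricted in \<open>est\<close>.\<close>
  moreover have "(\<Sum>j=1..N. \<gamma> (n (y j)) * norm (y j) - \<gamma> (n (x j)) * norm (x j))
      \<le> (\<Sum>j=1..N. (Zmat \<gamma> k (n (x j)) *v y j) \<bullet> (inverse (norm (x j)) *\<^sub>R (y j - x j)))"
    unfolding n_def x_def by (intro sum_mono est nondegenerate_slope[OF nd X2]) auto
  ultimately have "(\<Sum>j=1..N. \<gamma> (n (y j)) * norm (y j) - \<gamma> (n (x j)) * norm (x j)) / real N \<le> B"
    by (simp add: divide_right_mono)
  then have "energy \<gamma> \<sigma> Y cl' cr' - energy \<gamma> \<sigma> X cl cr \<le> B - \<sigma> * ((cr' - cr) - (cl' - cl))"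
    unfolding energy_eq_sum[OF N X2] energy_eq_sum[OF N Y2]
    by (simp add: sum_subtractf diff_divide_distrib algebra_simps x_def y_def n_def)
  \<comment> \<open>By \<open>2\<close> the left-hand side is \<open>\<Lambda>\<close> minus the
    contact point dissipation, and \<open>1\<close> expresses \<open>\<Lambda>\<close> through
    \<open>A\<close>.\<close>
  also have "\<dots> = - dt * (A + 1 / \<eta> * (((cr' - cr) / dt)\<^sup>2 + ((cl' - cl) / dt)\<^sup>2))"
  proof -
    have "1 / (\<eta> * dt) * ((cr' - cr)\<^sup>2 + (cl' - cl)\<^sup>2) = dt * (1 / \<eta> * (((cr' - cr) / dt)\<^sup>2 + ((cl' - cl) / dt)\<^sup>2))"
      using dt by (simp add: power_divide power2_eq_square[of dt] flip: add_divide_distrib)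
    then show ?thesis using 1 2 by (simp add: algebra_simps)
  qed
  finally have "(energy \<gamma> \<sigma> Y cl' cr' - energy \<gamma> \<sigma> X cl cr) / dt
      \<le> - (A + 1 / \<eta> * (((cr' - cr) / dt)\<^sup>2 + ((cl' - cl) / dt)\<^sup>2))"
    using dt by (simp only: pos_divide_le_eq) (simp add: algebra_simps)
  then show ?thesis by (simp add: A_def)
qed

section \<open>Conservation of mass\<close>

text \<open>The shoelace formula: the rotated slope is orthogonal to the element, so the integrand
  keeps its value at the left node.\<close>

lemma curve_integral_eq_sum:
  assumes N: "N \<ge> 1" and X: "X \<in> Vh2 N"
  shows "integral {0..1} (\<lambda>\<rho>. (X \<rho> \<bullet> normal X \<rho>) * norm (drho X \<rho>)) =
    - (\<Sum>j=1..N. X (node N (j - 1)) \<bullet> perp (X (node N j)))"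
proof -
  have "(X \<rho> \<bullet> normal X \<rho>) * norm (drho X \<rho>) = - (real N * (X (node N (j - 1)) \<bullet> perp (X (node N j))))"
    if j: "j \<in> {1..N}" and \<rho>: "\<rho> \<in> {node N (j-1)<..<node N j}" for j \<rho>
  proof -
    let ?s = "slope N X j"
    \<comment> \<open>On a collapsed element division by zero makes \<open>normal\<close> vanish,
      consistent with the right-hand side.\<close>
    have "(X \<rho> \<bullet> normal X \<rho>) * norm (drho X \<rho>) = - (X \<rho> \<bullet> perp ?s)"
      by (cases "?s = 0") (simp_all add: drho_Vh2[OF X j \<rho>] normal_def)
    also have "X \<rho> \<bullet> perp ?s = X (node N (j - 1)) \<bullet> perp ?s"
      using Vh2_affine[OF X j, of \<rho>] \<rho>
      by (simp add: inner_add_left inner_commute[of ?s] perp_orthogonal)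
    also have "\<dots> = real N * (X (node N (j - 1)) \<bullet> perp (X (node N j)))"
      by (simp add: slope_def inner_real2 algebra_simps)
    finally show ?thesis .
  qed
  from integral_piecewise_const[OF N this] show ?thesis
    using N by (simp add: sum_negf flip: sum_distrib_left)
qed

text \<open>Additivity of oriented integrals, valid for any order of the contact parameters.\<close>

lemma substrate_integral_split:
  assumes "substrate r L" "cl \<in> {0..L}" "cr \<in> {0..L}" "cl' \<in> {0..L}" "cr' \<in> {0..L}"
  defines "I \<equiv> \<lambda>a b. LBINT c=ereal a..ereal b. r c \<bullet> n_sub r L c"
  shows "I cl' cr' - I cl cr = I cr cr' - I cl cl'"
proof -
  obtain D where D0: "\<And>x. x \<in> {0..L} \<Longrightarrow> D 0 x = r x"
    and D: "\<And>j x. x \<in> {0..L} \<Longrightarrow> (D j has_vector_derivative D (Suc j) x) (at x within {0..L})"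
    using assms(1) unfolding substrate_def smooth_on_Icc_def by blast
  have L: "L > 0" using assms(1) by (simp add: substrate_def)
  have cD: "continuous_on {0..L} (D j)" for j
    by (rule continuous_on_vector_derivative[OF D])
  have "sub_deriv r L x = D 1 x" if "x \<in> {0..L}" for x
    using has_vector_derivative_transform[OF that, of r "D 0"] D[OF that, of 0] D0
    unfolding sub_deriv_def
    by (intro vector_derivative_within_closed_interval[OF L that]) auto
  then have eq: "r x \<bullet> n_sub r L x = D 0 x \<bullet> - perp (D 1 x)" if "x \<in> {0..L}" for x
    using that by (simp add: n_sub_def D0)
  have "continuous_on {0..L} (\<lambda>x. D 0 x \<bullet> - perp (D 1 x))"
    unfolding inner_real2 by (simp, intro continuous_intros cD)
  then have cont: "continuous_on {0..L} (\<lambda>x. r x \<bullet> n_sub r L x)"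
    using eq by (metis (no_types, lifting) continuous_on_cong)
  have "I a b + I b c = I a c" if "a \<in> {0..L}" "b \<in> {0..L}" "c \<in> {0..L}" for a b c
    unfolding I_def
  proof (rule interval_integral_sum)
    have "interval_lebesgue_integrable lborel (ereal (min a (min b c))) (ereal (max a (max b c)))
      (\<lambda>x. r x \<bullet> n_sub r L x)"
      by (intro interval_integrable_continuous_on continuous_on_subset[OF cont]) (use that in auto)
    then show "interval_lebesgue_integrable lborel (min (ereal a) (min (ereal b) (ereal c)))
      (max (ereal a) (max (ereal b) (ereal c))) (\<lambda>x. r x \<bullet> n_sub r L x)"
      by (simp flip: ereal_min ereal_max)
  qed
  \<comment> \<open>Two decompositions of the integral from \<open>cl\<close> to \<open>cr'\<close>:
    through \<open>cl'\<close> and through \<open>cr\<close>.\<close>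
  from this[of cl cl' cr'] this[of cl cr cr'] show ?thesis using assms by auto
qed

text \<open>The boundary term in \<open>F_area_eq\<close> turns the trapezoid into a cross product
  of the end points, the quantity that telescoping leaves in the mass balance.\<close>

lemma F_area_eq_perp:
  assumes "substrate r L" "c \<in> {0..L}" "c' \<in> {0..L}"
  shows "2 * F_area r L c c' = r c' \<bullet> perp (r c) - (LBINT s=c..c'. r s \<bullet> n_sub r L s)"
  unfolding F_area_eq[OF assms] inner_real2 perp_simps by (simp add: field_simps)

text \<open>Node 0 belongs to element 1 only and node \<open>N\<close> to element \<open>N\<close>
  only, so each end weight occurs once.\<close>

lemma sum_endpoint_weights:
  fixes a w :: "nat \<Rightarrow> real"
  assumes "N \<ge> 1" "\<And>j. j \<in> {1..N-1} \<Longrightarrow> w j = 0"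
  shows "(\<Sum>j=1..N. a j * (w j + w (j - 1))) = a 1 * w 0 + a N * w N"
proof -
  have "(\<Sum>j=1..N. a j * w j) = (\<Sum>j\<in>{N}. a j * w j)"
    using assms by (intro sum.mono_neutral_right) auto
  moreover have "(\<Sum>j=1..N. a j * w (j - 1)) = (\<Sum>j\<in>{1}. a j * w (j - 1))"
  proof (intro sum.mono_neutral_right ballI)
    fix j assume "j \<in> {1..N} - {1}"
    then have "j - 1 \<in> {1..N-1}" by auto
    from assms(2)[OF this] show "a j * w (j - 1) = 0" by simp
  qed (use assms(1) in auto)
  ultimately show ?thesis by (simp add: distrib_left sum.distrib)
qed

text \<open>For an edge from \<open>p\<close> to \<open>p'\<close> moved to \<open>q\<close>,
  \<open>q'\<close>: products within a time level form the shoelace increment, and the mixed ones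
  are a nodal difference that telescopes.\<close>

lemma cross_increment:
  fixes p p' q q' :: "real^2"
  shows "(q' + q - p' - p) \<bullet> perp (p' - p + (q' - q)) =
    2 * (q \<bullet> perp q' - p \<bullet> perp p' + (q' \<bullet> perp p' - q \<bullet> perp p))"
  by (simp add: inner_real2 algebra_simps)

text \<open>The constant test function removes the stiffness term. What remains is the shoelace
  increment, a telescoped term at the contact points, and the corrections, which replace that term
  by substrate integrals.\<close>

lemma scheme_step_mass:
  assumes N: "N \<ge> 1" and dt: "dt > 0" and sub: "substrate r L"
    and cl: "cl \<in> {0..L}" and cr: "cr \<in> {0..L}"
    and X: "X \<in> Sh N r cl cr" and nd: "nondegenerate N X"
    and step: "scheme_step \<gamma> k \<sigma> \<eta> dt r L N X cl cr Y \<mu> cl' cr'"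
  shows "mass r L Y cl' cr' = mass r L X cl cr"
proof -
  have ne: "r cl' \<noteq> r cl" "r cr' \<noteq> r cr" and Y: "Y \<in> Sh N r cl' cr'"
    and c': "cl' \<in> {0..L}" "cr' \<in> {0..L}"
    using step unfolding scheme_step_def by blast+
  have X2: "X \<in> Vh2 N" and Y2: "Y \<in> Vh2 N" using X Y by (auto simp: Sh_def)
  define p where "p j = X (node N j)" for j
  define q where "q j = Y (node N j)" for j
  have ends: "p 0 = r cl" "p N = r cr" "q 0 = r cl'" "q N = r cr'"
    using X Y by (auto simp: Sh_def p_def q_def node_N[OF N])
  have one: "(\<lambda>_. 1) \<in> Vh N" unfolding Vh_def by (auto, rule exI[of _ 0], rule exI[of _ 1], simp)
  obtain \<delta> where \<delta>: "is_delta_normal N r L X cl cr cl' cr' \<delta>"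
    and tests: "\<forall>\<phi>\<in>Vh N.
      1 / dt * lumped N (\<lambda>\<rho>. (Y \<rho> - X \<rho>) \<bullet> (normal_half X Y \<rho> + \<delta> \<rho>)) (\<lambda>\<rho>. \<phi> \<rho> * norm (drho X \<rho>))
      + L2ip (drho \<mu>) (\<lambda>\<rho>. drho \<phi> \<rho> * inverse (norm (drho X \<rho>))) = 0"
    by (rule scheme_step_equations[OF step]) (rule that)
  note test = bspec[OF tests one]
  note \<delta>' = \<delta>[unfolded is_delta_normal_def, folded p_def, folded ends]
  \<comment> \<open>The correction is parallel to the contact point displacement and divided by its
    squared length, so their product is a scalar free of that length.\<close>
  have cancel: "v \<bullet> ((a / (norm v)\<^sup>2) *\<^sub>R (b *\<^sub>R v)) = a * b" if "v \<noteq> 0" for v :: "real^2" and a b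
    using that by (simp add: power2_norm_eq_inner)
  have \<delta>2: "\<delta> \<in> Vh2 N" using \<delta> by (simp add: is_delta_normal_def)
  define x where "x = slope N X"
  define y where "y = slope N Y"
  have x: "x j = real N *\<^sub>R (p j - p (j - 1))" and y: "y j = real N *\<^sub>R (q j - q (j - 1))" for j
    by (simp_all add: x_def y_def slope_def p_def q_def)
  have x0: "x j \<noteq> 0" if "j \<in> {1..N}" for j
    using nondegenerate_slope[OF nd X2 that] by (simp add: x_def)
  define w where "w j = (q j - p j) \<bullet> \<delta> (node N j)" for j
  \<comment> \<open>The weight \<open>norm (x j)\<close> cancels the denominator of
    \<open>normal_half\<close>; freezing the slopes leaves a continuous function.\<close>
  define g where "g j \<rho> = - ((Y \<rho> - X \<rho>) \<bullet> perp (x j + y j)) / 2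
      + norm (x j) * ((Y \<rho> - X \<rho>) \<bullet> \<delta> \<rho>)" for j \<rho>
  have "lumped N (\<lambda>\<rho>. (Y \<rho> - X \<rho>) \<bullet> (normal_half X Y \<rho> + \<delta> \<rho>)) (\<lambda>\<rho>. 1 * norm (drho X \<rho>))
      = (\<Sum>j=1..N. g j (node N j) + g j (node N (j - 1))) / (2 * real N)"
  proof (rule lumped_piecewise_continuous[OF N])
    fix j \<rho> assume j: "j \<in> {1..N}" "\<rho> \<in> {node N (j-1)<..<node N j}"
    have "drho X \<rho> = x j" "drho Y \<rho> = y j"
      using drho_Vh2[OF X2 j] drho_Vh2[OF Y2 j] by (simp_all add: x_def y_def)
    then show "((Y \<rho> - X \<rho>) \<bullet> (normal_half X Y \<rho> + \<delta> \<rho>)) \<bullet> (1 * norm (drho X \<rho>)) = g j \<rho>"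
      using x0[OF j(1)] by (simp add: normal_half_def g_def inner_diff_right inner_add_right field_simps)
  next
    fix j assume "j \<in> {1..N}"
    show "continuous_on {0..1} (g j)"
      unfolding g_def by (intro continuous_intros Vh2_continuous[OF X2] Vh2_continuous[OF Y2] Vh2_continuous[OF \<delta>2]) auto
  qed
  moreover have "drho (\<lambda>_. 1::real) \<rho> = 0" for \<rho>
    by (simp add: drho_def)
  then have "L2ip (drho \<mu>) (\<lambda>\<rho>. drho (\<lambda>_. 1::real) \<rho> * inverse (norm (drho X \<rho>))) = 0"
    by (simp add: L2ip_def)
  ultimately have "(\<Sum>j=1..N. g j (node N j) + g j (node N (j - 1))) = 0"
    using test dt N by simp
  moreover have "g j (node N j) + g j (node N (j - 1)) =
      - real N * ((q (j-1) \<bullet> perp (q j) - p (j-1) \<bullet> perp (p j)) + (q j \<bullet> perp (p j) - q (j-1) \<bullet> perp (p (j-1))))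
      + norm (x j) * (w j + w (j - 1))" for j
  proof -
    have "g j (node N j) + g j (node N (j - 1)) =
       - ((q j + q (j - 1) - p j - p (j - 1)) \<bullet> perp (x j + y j)) / 2 + norm (x j) * (w j + w (j - 1))"
    proof -
      have "(q j + q (j - 1) - p j - p (j - 1)) \<bullet> v = (q j - p j) \<bullet> v + (q (j - 1) - p (j - 1)) \<bullet> v" for v
        by (simp add: inner_diff_left inner_add_left)
      then show ?thesis
        unfolding g_def p_def[symmetric] q_def[symmetric] w_def[symmetric]
        by (simp add: distrib_left add_divide_distrib)
    qed
    also have "perp (x j + y j) = real N *\<^sub>R perp (p j - p (j - 1) + (q j - q (j - 1)))"
      unfolding x y by (simp flip: scaleR_add_right add: perp_scaleR)
    finally show ?thesis by (simp add: cross_increment)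
  qed
  ultimately have "0 = (\<Sum>j=1..N.
      - real N * ((q (j-1) \<bullet> perp (q j) - p (j-1) \<bullet> perp (p j)) + (q j \<bullet> perp (p j) - q (j-1) \<bullet> perp (p (j-1))))
      + norm (x j) * (w j + w (j - 1)))"
    by simp
  also have "\<dots> = - real N * ((\<Sum>j=1..N. q (j-1) \<bullet> perp (q j)) - (\<Sum>j=1..N. p (j-1) \<bullet> perp (p j))
      + (\<Sum>j=1..N. q j \<bullet> perp (p j) - q (j-1) \<bullet> perp (p (j-1))))
      + (\<Sum>j=1..N. norm (x j) * (w j + w (j - 1)))"
    unfolding sum.distrib sum_distrib_left[symmetric] sum_subtractf[symmetric] by simp
  also have "(\<Sum>j=1..N. q j \<bullet> perp (p j) - q (j-1) \<bullet> perp (p (j-1))) = q N \<bullet> perp (p N) - q 0 \<bullet> perp (p 0)"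
    using sum_telescope''[of 0 N "\<lambda>j. q j \<bullet> perp (p j)"] by simp
  also have "(\<Sum>j=1..N. norm (x j) * (w j + w (j - 1))) = norm (x 1) * w 0 + norm (x N) * w N"
    using \<delta> by (intro sum_endpoint_weights[OF N]) (auto simp: w_def is_delta_normal_def)
  \<comment> \<open>The edge length in the correction cancels \<open>norm (x 1)\<close> up to the
    factor \<open>real N\<close>; the sign is that of \<open>\<delta>\<close> at the left
    end.\<close>
  also have "norm (x 1) * w 0 = - (2 * real N * F_area r L cl cl')"
  proof -
    have "\<delta> (node N 0) = - ((2 * F_area r L cl cl' / (norm (q 0 - p 0))\<^sup>2) *\<^sub>R
        ((1 / norm (p 1 - p 0)) *\<^sub>R (q 0 - p 0)))"
      using \<delta>' by blast
    moreover have "q 0 - p 0 \<noteq> 0" using ne by (simp add: ends)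
    ultimately have "w 0 = - (2 * F_area r L cl cl' * (1 / norm (p 1 - p 0)))"
      unfolding w_def by (metis cancel inner_minus_right)
    moreover have "p 1 - p 0 \<noteq> 0" using x0[of 1] N by (auto simp: x)
    ultimately show ?thesis by (simp add: x)
  qed
  also have "norm (x N) * w N = 2 * real N * F_area r L cr cr'"
  proof -
    have "\<delta> (node N N) = (2 * F_area r L cr cr' / (norm (q N - p N))\<^sup>2) *\<^sub>R
        ((1 / norm (p N - p (N - 1))) *\<^sub>R (q N - p N))"
      using \<delta>' by blast
    moreover have "q N - p N \<noteq> 0" using ne by (simp add: ends)
    ultimately have "w N = 2 * F_area r L cr cr' * (1 / norm (p N - p (N - 1)))"
      unfolding w_def by (metis cancel)
    moreover have "p N - p (N - 1) \<noteq> 0" using x0[of N] N by (auto simp: x)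
    ultimately show ?thesis by (simp add: x)
  qed
  finally have "real N * ((\<Sum>j=1..N. q (j-1) \<bullet> perp (q j)) - (\<Sum>j=1..N. p (j-1) \<bullet> perp (p j))
      + (q N \<bullet> perp (p N) - q 0 \<bullet> perp (p 0)) + 2 * F_area r L cl cl' - 2 * F_area r L cr cr') = 0"
    by (simp add: algebra_simps)
  then have "(\<Sum>j=1..N. q (j-1) \<bullet> perp (q j)) - (\<Sum>j=1..N. p (j-1) \<bullet> perp (p j))
      + (q N \<bullet> perp (p N) - q 0 \<bullet> perp (p 0)) + 2 * F_area r L cl cl' - 2 * F_area r L cr cr' = 0"
    using N by simp
  \<comment> \<open>The cross products at the contact points cancel against those in
    \<open>F_area_eq_perp\<close>.\<close>
  then have "(\<Sum>j=1..N. q (j-1) \<bullet> perp (q j)) - (\<Sum>j=1..N. p (j-1) \<bullet> perp (p j))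
      + (LBINT s=cr..cr'. r s \<bullet> n_sub r L s) - (LBINT s=cl..cl'. r s \<bullet> n_sub r L s) = 0"
    using F_area_eq_perp[OF sub cl c'(1)] F_area_eq_perp[OF sub cr c'(2)] by (simp add: ends)
  then show ?thesis
    using substrate_integral_split[OF sub cl cr c']
    unfolding mass_def curve_integral_eq_sum[OF N X2] curve_integral_eq_sum[OF N Y2]
    by (simp add: p_def q_def)
qed

theorem theorem4p3:
  fixes \<gamma> :: "real^2 \<Rightarrow> real"
  assumes "anisotropy \<gamma>"
    and "\<forall>n\<in>sphere 0 1. \<gamma> (- n) < 3 * \<gamma> n"
  shows "\<exists>k0::real. \<forall>k::real^2 \<Rightarrow> real. (\<forall>n\<in>sphere 0 1. k0 \<le> k n) \<longrightarrow>
    (\<forall>(\<sigma>::real) (\<eta>::real) (T::real) (K::nat) (dt::real) (r::real \<Rightarrow> real^2) (L::real) (N::nat)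
       (X::nat \<Rightarrow> real \<Rightarrow> real^2) (\<mu>::nat \<Rightarrow> real \<Rightarrow> real) (cl::nat \<Rightarrow> real) (cr::nat \<Rightarrow> real).
      \<eta> > 0 \<longrightarrow> T > 0 \<longrightarrow> K \<ge> 1 \<longrightarrow> dt = T / real K \<longrightarrow> N \<ge> 1 \<longrightarrow> substrate r L \<longrightarrow>
      scheme_solution \<gamma> k \<sigma> \<eta> dt r L N K X \<mu> cl cr \<longrightarrow>
      (\<forall>m<K.
        (energy \<gamma> \<sigma> (X (Suc m)) (cl (Suc m)) (cr (Suc m)) - energy \<gamma> \<sigma> (X m) (cl m) (cr m)) / dt
          + L2ip (\<lambda>\<rho>. (norm (drho (\<mu> (Suc m)) \<rho>))\<^sup>2) (\<lambda>\<rho>. inverse (norm (drho (X m) \<rho>)))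
          + 1 / \<eta> * (((cr (Suc m) - cr m) / dt)\<^sup>2 + ((cl (Suc m) - cl m) / dt)\<^sup>2) \<le> 0) \<and>
      (\<forall>m<K.
        mass r L (X (Suc m)) (cl (Suc m)) (cr (Suc m)) - mass r L (X m) (cl m) (cr m) = 0))"
proof -
  obtain k0 where est: "\<And>k x y n. (\<forall>n\<in>sphere 0 1. k0 \<le> k n) \<Longrightarrow> x \<noteq> 0 \<Longrightarrow>
    n = - ((1 / norm x) *\<^sub>R perp x) \<Longrightarrow>
    \<gamma> (- ((1 / norm y) *\<^sub>R perp y)) * norm y - \<gamma> n * norm x
      \<le> (Zmat \<gamma> k n *v y) \<bullet> (inverse (norm x) *\<^sub>R (y - x))"
    using anisotropy_energy_step[OF assms] by metis
  show ?thesis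
  \<comment> \<open>The threshold of the local estimate depends on \<open>\<gamma>\<close> alone, so
    it is fixed before \<open>k\<close> and all discrete data.\<close>
  proof (intro exI[of _ k0] allI impI)
    fix k \<sigma> \<eta> T K dt r L N X \<mu> cl cr
    assume k: "\<forall>n\<in>sphere 0 1. k0 \<le> k n" and T: "(T::real) > 0" "(K::nat) \<ge> 1" "dt = T / real K"
      and N: "N \<ge> 1" and sub: "substrate r L"
      and sol: "scheme_solution \<gamma> k \<sigma> \<eta> dt r L N K X \<mu> cl cr"
    have dt: "dt > 0" using T by simp
    have step: "scheme_step \<gamma> k \<sigma> \<eta> dt r L N (X m) (cl m) (cr m)
        (X (Suc m)) (\<mu> (Suc m)) (cl (Suc m)) (cr (Suc m))" and nd: "nondegenerate N (X m)"
      if "m < K" for m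
      using sol that unfolding scheme_solution_def by blast+
    \<comment> \<open>For \<open>m = 0\<close> this is the initial condition, otherwise part of the
      step that ended at \<open>m\<close>.\<close>
    have "cl m \<in> {0..L}" "cr m \<in> {0..L}" "X m \<in> Sh N r (cl m) (cr m)" if "m < K" for m
      using that sol step[of "m - 1"] unfolding scheme_solution_def scheme_step_def
      by (cases m; auto)+
    note X = this
    show "(\<forall>m<K.
        (energy \<gamma> \<sigma> (X (Suc m)) (cl (Suc m)) (cr (Suc m)) - energy \<gamma> \<sigma> (X m) (cl m) (cr m)) / dt
          + L2ip (\<lambda>\<rho>. (norm (drho (\<mu> (Suc m)) \<rho>))\<^sup>2) (\<lambda>\<rho>. inverse (norm (drho (X m) \<rho>)))
          + 1 / \<eta> * (((cr (Suc m) - cr m) / dt)\<^sup>2 + ((cl (Suc m) - cl m) / dt)\<^sup>2) \<le> 0) \<and>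
      (\<forall>m<K.
        mass r L (X (Suc m)) (cl (Suc m)) (cr (Suc m)) - mass r L (X m) (cl m) (cr m) = 0)"
      using scheme_step_energy[OF est[OF k] N dt X(3) nd step]
        scheme_step_mass[OF N dt sub X nd step] by auto
  qed
qed

end
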